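(* Let $\mathcal{P}$ be one class of generators of a hyperbolic quadric $\mathcal{Q}^{+}(7,q)$, and suppose $\mathcal{Q}^{+}(7,q)$ admits a spread all of whose elements lie in $\mathcal{P}$. Let $\mathcal{L}$ be a Cameron-Liebler set of $\mathcal{P}$ with parameter $x$. If $x\leq\frac{\sqrt{3}-1}{2}q$, then $\mathcal{L}$ is the union of $x$ point-pencils (restricted to $\mathcal{P}$) whose vertices are pairwise non-collinear, or $\mathcal{L}$ is the union of $x$ base-solids whose centers are pairwise disjoint.
   Context: $\mathcal{Q}^{+}(7,q)$ is the hyperbolic quadric in $\mathrm{PG}(7,q)$; its generators are 3-dimensional (projective) subspaces, falling into two classes: two generators are in the same class iff their intersection has odd projective dimension (i.e. dimension $3$, $1$ or $-1$, the empty space). A spread is a set of generators such that every point of the quadric lies in exactly one of them. For a class $\mathcal{P}$, a set $\mathcal{L}\subseteq\mathcal{P}$ is a Cameron-Liebler set with parameter $x=|\mathcal{L}|/((q+1)(q^2+1))$ if every $\pi\in\mathcal{P}$ is disjoint from exactly $(x-\chi_\pi)q^{3}$ elements of $\mathcal{L}$, where $\chi_\pi=1$ if $\pi\in\mathcal{L}$ and $0$ otherwise. A point-pencil restricted to $\mathcal{P}$ is the set of all generators in $\mathcal{P}$ through a fixed point (its vertex). A base-solid with center $\pi$, for $\pi$ a generator of the other class, is the set of all generators in $\mathcal{P}$ meeting $\pi$ in a plane. *)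

theory Defs
  imports "HOL-Analysis.Determinants"
begin

text \<open>
  \<open>PG(7,q)\<close> is modelled by \<^typ>\<open>'a^8\<close> over a finite field \<open>'a\<close> with \<open>q = CARD('a)\<close>: a projective
  subspace is a vector subspace, its projective dimension is the vector space dimension minus one,
  and the empty projective subspace is \<open>{0}\<close>, of dimension \<open>-1\<close>.
\<close>

definition proj_dim :: "('a::field^'n) set \<Rightarrow> int" where
  "proj_dim U = int (vec.dim U) - 1"

definition proj_disjoint :: "('a::field^'n) set \<Rightarrow> ('a^'n) set \<Rightarrow> bool" where
  "proj_disjoint U W \<longleftrightarrow> U \<inter> W = {0}"

text \<open>The eight coordinates are indexed by the residues \<open>0, \<dots>, 7\<close> of the numeral type \<open>8\<close>.\<close>

definition canonical_hyperbolic_form :: "'a::field^8 \<Rightarrow> 'a" where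
  "canonical_hyperbolic_form v = v$0 * v$1 + v$2 * v$3 + v$4 * v$5 + v$6 * v$7"

text \<open>
  A quadric is given by its quadratic form. It is a \<open>Q\<^sup>+(7,q)\<close> if some change of coordinates brings
  the form into canonical shape; nonzero scalar factors are absorbed by the change of coordinates.
\<close>

definition hyperbolic_quadric :: "('a::field^8 \<Rightarrow> 'a) \<Rightarrow> bool" where
  "hyperbolic_quadric Q \<longleftrightarrow>
     (\<exists>A :: 'a^8^8. invertible A \<and> (\<forall>v. Q v = canonical_hyperbolic_form (A *v v)))"

definition on_quadric :: "('a::field^8 \<Rightarrow> 'a) \<Rightarrow> ('a^8) set \<Rightarrow> bool" where
  "on_quadric Q U \<longleftrightarrow> vec.subspace U \<and> (\<forall>v\<in>U. Q v = 0)"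

definition points :: "('a::field^8 \<Rightarrow> 'a) \<Rightarrow> ('a^8) set set" where
  "points Q = {p. on_quadric Q p \<and> proj_dim p = 0}"

definition generators :: "('a::field^8 \<Rightarrow> 'a) \<Rightarrow> ('a^8) set set" where
  "generators Q = {\<pi>. on_quadric Q \<pi> \<and> proj_dim \<pi> = 3}"

text \<open>Collinearity in the polar space: the line joining the points lies on the quadric.\<close>

definition quadric_collinear :: "('a::field^8 \<Rightarrow> 'a) \<Rightarrow> ('a^8) set \<Rightarrow> ('a^8) set \<Rightarrow> bool" where
  "quadric_collinear Q p r \<longleftrightarrow> on_quadric Q (vec.span (p \<union> r))"

definition same_class :: "('a::field^8 \<Rightarrow> 'a) \<Rightarrow> (('a^8) set \<times> ('a^8) set) set" where
  "same_class Q = {(\<pi>, \<tau>). \<pi> \<in> generators Q \<and> \<tau> \<in> generators Q \<and> odd (proj_dim (\<pi> \<inter> \<tau>))}"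

definition generator_classes :: "('a::field^8 \<Rightarrow> 'a) \<Rightarrow> ('a^8) set set set" where
  "generator_classes Q = generators Q // same_class Q"

definition spread :: "('a::field^8 \<Rightarrow> 'a) \<Rightarrow> ('a^8) set set \<Rightarrow> bool" where
  "spread Q S \<longleftrightarrow> S \<subseteq> generators Q \<and> (\<forall>p\<in>points Q. \<exists>!\<pi>. \<pi> \<in> S \<and> p \<subseteq> \<pi>)"

text \<open>The parameter \<open>x\<close> is a real number; its integrality is not part of the definition.\<close>

definition cameron_liebler_set ::
    "('a::{field,finite}^8) set set \<Rightarrow> ('a^8) set set \<Rightarrow> real \<Rightarrow> bool" where
  "cameron_liebler_set P L x \<longleftrightarrow>
     L \<subseteq> P \<and>
     x = real (card L) / ((real CARD('a) + 1) * (real CARD('a) ^ 2 + 1)) \<and>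
     (\<forall>\<pi>\<in>P. real (card {\<tau>\<in>L. proj_disjoint \<pi> \<tau>}) = (x - of_bool (\<pi> \<in> L)) * real CARD('a) ^ 3)"

definition point_pencil :: "('a::field^8) set set \<Rightarrow> ('a^8) set \<Rightarrow> ('a^8) set set" where
  "point_pencil P p = {\<pi>\<in>P. p \<subseteq> \<pi>}"

definition base_solid :: "('a::field^8) set set \<Rightarrow> ('a^8) set \<Rightarrow> ('a^8) set set" where
  "base_solid P \<pi> = {\<tau>\<in>P. proj_dim (\<tau> \<inter> \<pi>) = 2}"

end

theory Submission imports Defs begin

text \<open>
  Write \<open>\<pi> \<sim> \<tau>\<close> if the generators \<open>\<pi>, \<tau>\<close> of \<open>P\<close> are not disjoint. For \<open>\<pi> \<in> L\<close> every
  \<open>\<tau> \<sim> \<pi>\<close> other than \<open>\<pi>\<close> meets \<open>\<pi>\<close> in a line \<open>l\<close>; let \<open>t(l)\<close> be the number of members of \<open>L\<close> through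
  \<open>l\<close>, out of \<open>q + 1\<close> members of \<open>P\<close>. Summing the Cameron-Liebler condition over these shows that
  \<open>q\<^sup>2 t(l) + x(q + 1)\<close> members of \<open>L\<close> meet \<open>l\<close>, and from this that either \<open>t(l) = q + 1\<close> (\<open>l\<close> is full)
  or \<open>t(l) \<le> x\<close>. For disjoint \<open>\<pi>, \<rho>\<close> in \<open>P\<close> the number of \<open>\<tau> \<in> L\<close> with \<open>\<tau> \<sim> \<pi>, \<rho>\<close> is
  \<open>q\<^sup>2([\<pi> \<in> L] + [\<rho> \<in> L]) + x(q + 1)\<close>, which determines the sum of \<open>x + q - t(\<pi> \<inter> \<tau>)\<close> over
  \<open>\<tau> \<sim> \<pi>\<close>; together with the gap for \<open>t\<close> it forces many full lines in \<open>\<pi>\<close>. Two full lines of \<open>\<pi>\<close> always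
  meet, as otherwise \<open>x \<ge> q + 1\<close>, so the full lines share a point or lie in a plane, that is, in
  one point-pencil or base-solid \<open>M\<close>. Its members meet pairwise, so if some \<open>\<rho> \<in> M\<close> were not in \<open>L\<close>,
  then \<open>|L \<inter> M| \<le> x(q\<^sup>2 + q + 1)\<close>, which is too small as soon as \<open>2x \<le> q + 2\<close>. Hence \<open>L\<close> is a union
  of point-pencils and base-solids; two of them sharing a member of \<open>L\<close> would give disjoint full
  lines, and a point-pencil always shares a member of \<open>P\<close> with a base-solid.
\<close>

section \<open>Linear algebra over a finite field\<close>

text \<open>Induction on a basis: a new basis vector \<open>b\<close> multiplies the count by the
  order of the field, since \<open>(k, s)\<close> maps bijectively to
  \<open>k *s b + s\<close>.\<close>

lemma card_subspace:
  fixes U :: "('a::{field,finite}^'n) set"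
  assumes "vec.subspace U"
  shows "card U = CARD('a) ^ vec.dim U"
proof -
  have span: "card (vec.span S) = CARD('a) ^ card S"
    if "finite S" "vec.independent S" for S :: "('a^'n) set"
    using that
  proof (induction S)
    case empty
    then show ?case by simp
  next
    case (insert b S)
    have b: "b \<notin> vec.span S" and ind: "vec.independent S"
      using insert.hyps insert.prems by (auto simp: vec.independent_insert)
    let ?f = "\<lambda>(k, s). k *s b + s"
    have "inj_on ?f (UNIV \<times> vec.span S)"
    proof (rule inj_onI, clarify)
      fix k s k' s'
      assume s: "s \<in> vec.span S" "s' \<in> vec.span S" and eq: "k *s b + s = k' *s b + s'"
      then have "(k - k') *s b = s' - s"
        by (simp add: vec.scale_left_diff_distrib) (metis add_diff_cancel_left' add_diff_eq diff_add_eq diff_diff_eq2)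
      then have "(k - k') *s b \<in> vec.span S"
        using s by (simp add: vec.span_diff)
      then have "k = k'"
        using b vec.span_scale[of "(k - k') *s b" S "inverse (k - k')"]
        by (cases "k = k'") simp_all
      with eq show "k = k' \<and> s = s'" by simp
    qed
    moreover have "?f ` (UNIV \<times> vec.span S) = vec.span (insert b S)"
    proof (intro equalityI subsetI)
      fix v assume "v \<in> ?f ` (UNIV \<times> vec.span S)"
      then obtain k s where "s \<in> vec.span S" "v = k *s b + s" by auto
      then show "v \<in> vec.span (insert b S)"
        unfolding vec.span_breakdown_eq by (intro exI[of _ k]) simp
    next
      fix v assume "v \<in> vec.span (insert b S)"
      then obtain k where "v - k *s b \<in> vec.span S" unfolding vec.span_breakdown_eq by blast
      then have "v = ?f (k, v - k *s b)" "(k, v - k *s b) \<in> UNIV \<times> vec.span S" by simp_all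
      then show "v \<in> ?f ` (UNIV \<times> vec.span S)" by (rule image_eqI)
    qed
    ultimately have "card (vec.span (insert b S)) = CARD('a) * card (vec.span S)"
      by (metis card_cartesian_product card_image)
    then show ?case using insert ind by simp
  qed
  obtain S where S: "S \<subseteq> U" "vec.independent S" "U \<subseteq> vec.span S" "card S = vec.dim U"
    using vec.basis_exists by metis
  then have "vec.span S = U" using assms by (simp add: vec.span_subspace)
  with span[of S] S show ?thesis by simp
qed

lemma card_subspace_nonzero:
  fixes U :: "('a::{field,finite}^'n) set"
  assumes "vec.subspace U"
  shows "real (card (U - {0})) = real CARD('a) ^ vec.dim U - 1"
proof -
  have "card U > 0" using vec.subspace_0[OF assms] by (auto simp: card_gt_0_iff)
  then show ?thesis using vec.subspace_0[OF assms] card_subspace[OF assms]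
    by (simp add: card_Diff_singleton of_nat_diff Suc_leI)
qed

lemma card_subspace_diff:
  fixes U :: "('a::{field,finite}^'n) set"
  assumes "vec.subspace U" "vec.subspace W" "W \<subseteq> U"
  shows "real (card (U - W)) = real CARD('a) ^ vec.dim U - real CARD('a) ^ vec.dim W"
  using assms card_mono[OF _ assms(3)] by (simp add: card_Diff_subset card_subspace of_nat_diff)

lemma two_le_CARD: "CARD('a::{field,finite}) \<ge> 2"
proof -
  have "card {0, 1 :: 'a} \<le> CARD('a)" by (rule card_mono) auto
  then show ?thesis by simp
qed

text \<open>The projective subspace generated by \<open>U\<close> and \<open>W\<close>. The
  elementwise form hands over the splitting v = u + w directly.\<close>

definition join :: "('a::field^'n) set \<Rightarrow> ('a^'n) set \<Rightarrow> ('a^'n) set" where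
  "join U W = {u + w | u w. u \<in> U \<and> w \<in> W}"

lemma joinI [intro]: "u \<in> U \<Longrightarrow> w \<in> W \<Longrightarrow> u + w \<in> join U W"
  by (auto simp: join_def)

lemma joinE [elim]:
  assumes "v \<in> join U W" obtains u w where "u \<in> U" "w \<in> W" "v = u + w"
  using assms by (auto simp: join_def)

lemma subspace_join: "vec.subspace U \<Longrightarrow> vec.subspace W \<Longrightarrow> vec.subspace (join U W)"
  unfolding join_def by (rule vec.subspace_sums)

lemma dim_join:
  "vec.subspace U \<Longrightarrow> vec.subspace W \<Longrightarrow>
    vec.dim (join U W) + vec.dim (U \<inter> W) = vec.dim U + vec.dim W"
  unfolding join_def by (rule vec.dim_sums_Int)

lemma join_upper1: "vec.subspace W \<Longrightarrow> U \<subseteq> join U W"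
  using vec.subspace_0 by (force simp: join_def)

lemma join_upper2: "vec.subspace U \<Longrightarrow> W \<subseteq> join U W"
  using vec.subspace_0 by (force simp: join_def)

lemma join_least:
  "vec.subspace X \<Longrightarrow> U \<subseteq> X \<Longrightarrow> W \<subseteq> X \<Longrightarrow> join U W \<subseteq> X"
  by (auto intro: vec.subspace_add elim!: joinE)

lemma join_span_singleton:
  "vec.subspace U \<Longrightarrow> join U (vec.span {v}) = vec.span (insert v U)"
  using vec.span_Un[of U "{v}"] by (simp add: join_def vec.span_eq_iff[THEN iffD2])

lemma span_insert_span: "vec.span (insert v (vec.span S)) = vec.span (insert v S)"
  by (rule set_eqI) (simp only: vec.span_breakdown_eq vec.span_span)

lemma dim_span_insert:
  "vec.subspace U \<Longrightarrow> v \<notin> U \<Longrightarrow> vec.dim (vec.span (insert v U)) = Suc (vec.dim U)"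
  by (simp add: vec.dim_insert vec.span_eq_iff[THEN iffD2])

lemma dim_zero_iff: "vec.subspace U \<Longrightarrow> vec.dim U = 0 \<longleftrightarrow> U = {0}"
  using vec.subspace_0[of U] by auto

lemma eq_of_dim_le:
  "vec.subspace U \<Longrightarrow> vec.subspace W \<Longrightarrow> U \<subseteq> W \<Longrightarrow> vec.dim W \<le> vec.dim U \<Longrightarrow> U = W"
  by (rule vec.subspace_dim_equal)

lemma dim_pair:
  "vec.dim (vec.span {a, b}) = 2" if "a \<noteq> 0" "b \<notin> vec.span {a}"
proof -
  have "{a, b} = {b, a}" by auto
  then show ?thesis using that vec.dim_insert[of b "{a}"] by simp
qed

text \<open>Every \<open>v\<close> in \<open>W\<close> is a multiple of \<open>w\<close> plus the
  kernel vector v - (f v / f w) w, so the kernel loses exactly one dimension.\<close>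

lemma dim_kernel:
  fixes W :: "('a::field^'n) set" and f :: "'a^'n \<Rightarrow> 'a"
  assumes W: "vec.subspace W"
    and add: "\<And>u v. f (u + v) = f u + f v" and scale: "\<And>c v. f (c *s v) = c * f v"
    and w: "w \<in> W" "f w \<noteq> 0"
  shows "vec.dim W = Suc (vec.dim {v\<in>W. f v = 0})"
proof -
  let ?K = "{v\<in>W. f v = 0}"
  have f0: "f 0 = 0" using scale[of 0 0] by simp
  have K: "vec.subspace ?K"
    using W f0 by (auto simp: vec.subspace_def add scale)
  have "W = vec.span (insert w ?K)"
  proof (intro equalityI subsetI)
    fix v assume v: "v \<in> W"
    have "f (v - (f v / f w) *s w) = f v + (- (f v / f w)) * f w"
      using add[of v "(- (f v / f w)) *s w"] scale[of "- (f v / f w)" w] by simp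
    then have "v - (f v / f w) *s w \<in> ?K"
      using v w W by (simp add: vec.subspace_diff vec.subspace_scale)
    then show "v \<in> vec.span (insert w ?K)"
      unfolding vec.span_breakdown_eq vec.span_eq_iff[THEN iffD2, OF K] by blast
  next
    fix v assume "v \<in> vec.span (insert w ?K)"
    then show "v \<in> W"
      using vec.span_minimal[of "insert w ?K" W] W w by auto
  qed
  then show ?thesis using dim_span_insert[OF K, of w] w by simp
qed

lemma sum_card_swap:
  "finite A \<Longrightarrow> finite B \<Longrightarrow>
    (\<Sum>a\<in>A. real (card {b\<in>B. R a b})) = (\<Sum>b\<in>B. real (card {a\<in>A. R a b}))"
  using sum_multicount_gen[of A B R "\<lambda>b. card {a\<in>A. R a b}"]
  by (simp flip: of_nat_sum)

text \<open>Extend \<open>a\<close> to a basis of \<open>E\<close> and drop it again: the other two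
  basis vectors span the line.\<close>

lemma avoiding_line_in_plane:
  fixes E :: "('a::field^'n) set"
  assumes E: "vec.subspace E" "vec.dim E = 3" and a: "a \<in> E" "a \<noteq> 0"
  obtains m where "vec.subspace m" "vec.dim m = 2" "m \<subseteq> E" "a \<notin> m"
proof -
  obtain S where S: "{a} \<subseteq> S" "S \<subseteq> E" "vec.independent S" "E \<subseteq> vec.span S"
    using vec.maximal_independent_subset_extend[of "{a}" E] a by auto
  have "card S = 3" using vec.basis_card_eq_dim[of S E] S E by simp
  then have card: "card (S - {a}) = 2" using S by (simp add: card_Diff_singleton)
  have ind: "vec.independent (S - {a})" using vec.independent_mono[OF S(3)] by simp
  show ?thesis
  proof (rule that)
    show "vec.dim (vec.span (S - {a})) = 2"
      using vec.dim_span_eq_card_independent[OF ind] card by simp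
    show "a \<notin> vec.span (S - {a})" using S unfolding vec.dependent_def by auto
    show "vec.span (S - {a}) \<subseteq> E" using S E by (intro vec.span_minimal) auto
  qed simp
qed

lemma sum_of_bool:
  fixes c d :: real
  assumes "finite A"
  shows "(\<Sum>a\<in>A. c + d * of_bool (R a)) = c * card A + d * card {a\<in>A. R a}"
  using assms by (simp add: sum.distrib sum_of_bool_eq Int_def flip: sum_distrib_left)

lemma sum_of_bool2:
  fixes c d :: real
  assumes "finite A"
  shows "(\<Sum>a\<in>A. c * of_bool (R a) + d * of_bool (S a))
    = c * card {a\<in>A. R a} + d * card {a\<in>A. S a}"
  using assms by (simp add: sum.distrib sum_of_bool_eq Int_def flip: sum_distrib_left)

lemma span_insert_subset_iff:
  "vec.subspace W \<Longrightarrow> vec.span (insert v U) \<subseteq> W \<longleftrightarrow> v \<in> W \<and> U \<subseteq> W"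
  using vec.span_superset[of "insert v U"] vec.span_minimal[of "insert v U" W] by blast

lemma in_span_pair: "v \<in> vec.span {a, b} \<longleftrightarrow> (\<exists>\<alpha> \<beta>. v = \<alpha> *s a + \<beta> *s b)"
  unfolding vec.span_breakdown_eq vec.span_empty singleton_iff by (simp add: diff_diff_eq)

lemma direct_sum_unique:
  assumes "vec.subspace U" "vec.subspace W" "U \<inter> W = {0}"
    and "u \<in> U" "u' \<in> U" "w \<in> W" "w' \<in> W" "u + w = u' + w'"
  shows "u = u'" "w = w'"
proof -
  have "u - u' = w' - w" using assms(8) by (simp add: algebra_simps)
  moreover have "u - u' \<in> U" "w' - w \<in> W" using assms by (auto intro: vec.subspace_diff)
  ultimately have "u - u' \<in> U \<inter> W" by simp
  then show "u = u'" using assms(3) by simp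
  then show "w = w'" using assms(8) by simp
qed

lemma card_remove:
  fixes A :: "'b::finite set"
  assumes "a \<in> A" shows "real (card (A - {a})) = real (card A) - 1"
proof -
  have "Suc (card (A - {a})) = card A" using assms by (intro card_Suc_Diff1) simp_all
  then show ?thesis by simp
qed

lemma span_pair_subset: "vec.subspace W \<Longrightarrow> a \<in> W \<Longrightarrow> b \<in> W \<Longrightarrow> vec.span {a, b} \<subseteq> W"
  by (intro vec.span_minimal) auto

lemma line_subset:
  fixes l :: "('a::field^'n) set"
  assumes l: "vec.subspace l" "vec.dim l = 2" and ab: "a \<in> l" "b \<in> l" "a \<noteq> 0" "b \<notin> vec.span {a}"
    and E: "vec.subspace E" "a \<in> E" "b \<in> E"
  shows "l \<subseteq> E"
proof -
  have "vec.span {a, b} = l"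
    using l ab dim_pair[OF ab(3,4)] by (intro eq_of_dim_le vec.span_minimal) auto
  moreover have "vec.span {a, b} \<subseteq> E" using E by (intro vec.span_minimal) auto
  ultimately show ?thesis by simp
qed

text \<open>If w = \<alpha> a + \<beta> v lies in \<open>m\<close>, then \<beta> vanishes because
  \<open>v\<close> is outside the span of \<open>a\<close> and \<open>m\<close>, and then \<alpha>
  vanishes because \<open>a\<close> is outside \<open>m\<close>.\<close>

lemma disjoint_span_pair:
  assumes m: "vec.subspace m" and a: "a \<notin> m" and v: "v \<notin> vec.span (insert a m)"
  shows "m \<inter> vec.span {a, v} = {0}"
proof -
  have "w = 0" if wm: "w \<in> m" and wav: "w \<in> vec.span {a, v}" for w
  proof -
    obtain \<alpha> \<beta> where w: "w = \<alpha> *s a + \<beta> *s v" using wav unfolding in_span_pair by blast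
    let ?S = "vec.span (insert a m)"
    have aS: "a \<in> ?S" "w \<in> ?S" using wm by (auto intro: vec.span_base)
    have "\<beta> *s v = w - \<alpha> *s a" using w by simp
    then have "\<beta> *s v \<in> ?S" using aS by (simp add: vec.span_diff vec.span_scale)
    then have "\<beta> = 0"
      using v vec.span_scale[of "\<beta> *s v" "insert a m" "inverse \<beta>"] by (cases "\<beta> = 0") simp_all
    then have "\<alpha> *s a \<in> m" using w wm by simp
    then have "\<alpha> = 0"
      using a vec.subspace_scale[OF m, of "\<alpha> *s a" "inverse \<alpha>"] by (cases "\<alpha> = 0") simp_all
    then show "w = 0" using w \<open>\<beta> = 0\<close> by simp
  qed
  then show ?thesis using vec.subspace_0[OF m] vec.span_zero by blast
qed

text \<open>A line not contained in the plane meets it in at most one point, and a line of the plane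
  that avoids this point will do. If there is no common point, the point \<open>a\<close> to be
  avoided is arbitrary.\<close>

lemma disjoint_line_in_plane:
  fixes E l :: "('a::field^'n) set"
  assumes E: "vec.subspace E" "vec.dim E = 3" and l: "vec.subspace l" "vec.dim l = 2" "\<not> l \<subseteq> E"
  obtains m where "vec.subspace m" "vec.dim m = 2" "m \<subseteq> E" "l \<inter> m = {0}"
proof -
  have sub: "vec.subspace (l \<inter> E)" using l E by (simp add: vec.subspace_inter)
  obtain a where a: "a \<in> E" "a \<noteq> 0" "l \<inter> E \<subseteq> vec.span {a}"
  proof (cases "l \<inter> E = {0}")
    case True
    have "E \<noteq> {0}" using E by auto
    then obtain a where "a \<in> E" "a \<noteq> 0" using vec.subspace_0[OF E(1)] by blast
    then show ?thesis using that[of a] True by (simp add: vec.span_zero)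
  next
    case False
    then obtain a where a: "a \<in> l \<inter> E" "a \<noteq> 0" using vec.subspace_0[OF sub] by blast
    have "b \<in> vec.span {a}" if "b \<in> l \<inter> E" for b
    proof (rule ccontr)
      assume "b \<notin> vec.span {a}"
      then have "l \<subseteq> E" using line_subset[OF l(1,2), of a b E] a that E by blast
      then show False using l by blast
    qed
    then show ?thesis using that[of a] a by blast
  qed
  obtain m where m: "vec.subspace m" "vec.dim m = 2" "m \<subseteq> E" "a \<notin> m"
    by (rule avoiding_line_in_plane[OF E a(1,2)])
  have "w = 0" if w: "w \<in> l" "w \<in> m" for w
  proof -
    have "w \<in> vec.span {a}" using a w m by blast
    then obtain c where c: "w = c *s a" by (auto simp: vec.span_singleton)
    then have "c = 0"
      using m(4) vec.subspace_scale[OF m(1), of w "inverse c"] w by (cases "c = 0") simp_all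
    then show "w = 0" using c by simp
  qed
  then have "l \<inter> m = {0}" using vec.subspace_0[OF l(1)] vec.subspace_0[OF m(1)] by blast
  then show ?thesis using that m by blast
qed

text \<open>Let \<open>l\<close> and \<open>m\<close> meet in \<open>c\<close> and let
  \<open>n\<close> avoid \<open>c\<close>. A line avoiding \<open>c\<close> meets \<open>l\<close>
  and \<open>m\<close> in different points and so lies in their plane; this applies to
  \<open>n\<close>. A line through \<open>c\<close> meets \<open>n\<close> in a second point of that
  plane and so lies there as well.\<close>

lemma pairwise_meeting_lines:
  fixes F :: "('a::field^'n) set set"
  assumes F: "\<And>l. l \<in> F \<Longrightarrow> vec.subspace l \<and> vec.dim l = 2"
    and meet: "\<And>l m. l \<in> F \<Longrightarrow> m \<in> F \<Longrightarrow> l \<inter> m \<noteq> {0}"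
    and nostar: "\<And>c. c \<noteq> 0 \<Longrightarrow> \<exists>l\<in>F. c \<notin> l"
    and ne: "F \<noteq> {}"
  obtains l m where "l \<in> F" "m \<in> F" "vec.dim (join l m) = 3" "\<forall>k\<in>F. k \<subseteq> join l m"
proof -
  have pt: "\<exists>c. c \<noteq> 0 \<and> c \<in> l \<and> c \<in> m" if "l \<in> F" "m \<in> F" for l m
    using meet[OF that] F[OF that(1)] F[OF that(2)] vec.subspace_0[of l] vec.subspace_0[of m] by blast
  obtain l where l: "l \<in> F" using ne by blast
  \<comment> \<open>A line of \<open>F\<close> meets itself, which supplies a nonzero vector;
    avoiding it makes \<open>m\<close> different from \<open>l\<close>.\<close>
  obtain a where a: "a \<noteq> 0" "a \<in> l" using pt[OF l l] by blast
  obtain m where m: "m \<in> F" "a \<notin> m" using nostar[OF a(1)] by blast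
  obtain c where c: "c \<noteq> 0" "c \<in> l" "c \<in> m" using pt[OF l m(1)] by blast
  obtain n where n: "n \<in> F" "c \<notin> n" using nostar[OF c(1)] by blast
  note sub = F[OF l] F[OF m(1)] F[OF n(1)]
  let ?E = "join l m"
  have Es: "vec.subspace ?E" using sub by (simp add: subspace_join)
  have lE: "l \<subseteq> ?E" and mE: "m \<subseteq> ?E" using join_upper1[of m l] join_upper2[of l m] sub by auto
  have lm: "l \<inter> m \<subseteq> vec.span {c}"
  proof (rule ccontr)
    assume "\<not> ?thesis"
    then obtain b where "b \<in> l" "b \<in> m" "b \<notin> vec.span {c}" by blast
    then have "l \<subseteq> m" using line_subset[of l c b m] sub c by blast
    then show False using a m by blast
  qed
  have "vec.dim (l \<inter> m) = 1"
  proof -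
    have "vec.span {c} = l \<inter> m"
      using lm c sub vec.span_minimal[of "{c}" "l \<inter> m"] by (simp add: subset_antisym vec.subspace_inter)
    moreover have "vec.dim (vec.span {c}) = 1" using c by simp
    ultimately show ?thesis by simp
  qed
  then have dimE: "vec.dim ?E = 3" using dim_join[of l m] sub by simp
  have off: "k \<subseteq> ?E" if k: "k \<in> F" "c \<notin> k" for k
  proof -
    obtain u where u: "u \<noteq> 0" "u \<in> k" "u \<in> l" using pt[OF k(1) l] by blast
    obtain v where v: "v \<noteq> 0" "v \<in> k" "v \<in> m" using pt[OF k(1) m(1)] by blast
    have "v \<notin> vec.span {u}"
    proof
      assume "v \<in> vec.span {u}"
      then have "v \<in> l" using u sub vec.span_minimal[of "{u}" l] by blast
      then obtain r where r: "v = r *s c" using v lm by (auto simp: vec.span_singleton)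
      then have "c = inverse r *s v" using v by auto
      then have "c \<in> k" using v F[OF k(1)] by (simp add: vec.subspace_scale)
      then show False using k by simp
    qed
    then show ?thesis using line_subset[of k u v ?E] F[OF k(1)] u v Es lE mE by blast
  qed
  have "k \<subseteq> ?E" if k: "k \<in> F" for k
  proof (cases "c \<in> k")
    case False
    then show ?thesis using off k by blast
  next
    case True
    obtain u where u: "u \<noteq> 0" "u \<in> k" "u \<in> n" using pt[OF k n(1)] by blast
    have "u \<notin> vec.span {c}"
    proof
      assume "u \<in> vec.span {c}"
      then obtain r where r: "u = r *s c" by (auto simp: vec.span_singleton)
      then have "c = inverse r *s u" using u by auto
      then have "c \<in> n" using u sub by (simp add: vec.subspace_scale)
      then show False using n by simp
    qed
    moreover have "u \<in> ?E" using off[OF n] u by blast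
    ultimately show ?thesis using line_subset[of k c u ?E] F[OF k] True u Es c lE by blast
  qed
  then show ?thesis using that l m(1) dimE by blast
qed

section \<open>Generators of the hyperbolic quadric\<close>

text \<open>\<open>q\<close> is a locale parameter because a locale abbreviation for \<open>CARD('a)\<close> would acquire an
  explicit type argument.\<close>

locale hyperbolic_space =
  fixes Q :: "'a::{field,finite}^8 \<Rightarrow> 'a" and q :: real
  assumes hyperbolic: "hyperbolic_quadric Q" and q_eq: "q = real CARD('a)"
begin

text \<open>The polar form of \<open>Q\<close>, obtained without a division by 2, so that
  characteristic 2 needs no separate treatment.\<close>

definition B :: "'a^8 \<Rightarrow> 'a^8 \<Rightarrow> 'a" where
  "B u v = Q (u + v) - Q u - Q v"

lemma Q_add: "Q (u + v) = Q u + Q v + B u v"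
  by (simp add: B_def)

lemma B_commute: "B u v = B v u"
  by (simp add: B_def add.commute)

lemma form_facts:
  shows Q_scale: "Q (c *s v) = c\<^sup>2 * Q v"
    and B_add_left: "B (u + v) w = B u w + B v w"
    and B_scale_left: "B (c *s v) w = c * B v w"
    and B_nondegenerate: "(\<And>w. B v w = 0) \<Longrightarrow> v = 0"
proof -
  obtain A :: "'a^8^8" where A: "invertible A" and Q: "\<And>v. Q v = canonical_hyperbolic_form (A *v v)"
    using hyperbolic unfolding hyperbolic_quadric_def by blast
  let ?b = "\<lambda>u v :: 'a^8. u$0 * v$1 + u$1 * v$0 + u$2 * v$3 + u$3 * v$2
      + u$4 * v$5 + u$5 * v$4 + u$6 * v$7 + u$7 * v$6"
  have B: "B u v = ?b (A *v u) (A *v v)" for u v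
    by (simp add: B_def Q canonical_hyperbolic_form_def matrix_vector_right_distrib algebra_simps)
  show "Q (c *s v) = c\<^sup>2 * Q v"
    by (simp add: Q canonical_hyperbolic_form_def vector_scalar_commute power2_eq_square algebra_simps)
  show "B (u + v) w = B u w + B v w"
    by (simp add: B matrix_vector_right_distrib algebra_simps)
  show "B (c *s v) w = c * B v w"
    by (simp add: B vector_scalar_commute algebra_simps)
  show "v = 0" if "\<And>w. B v w = 0"
  proof -
    obtain A' where A': "A' ** A = mat 1" "A ** A' = mat 1"
      using A by (auto simp: invertible_def)
    let ?u = "A *v v"
    \<comment> \<open>Invertibility of \<open>A\<close> lets \<open>w\<close> be any vector. A unit
      vector then reads off the coordinate paired with its own in the canonical form.\<close>
    have *: "?b ?u w = 0" for w
      using that[of "A' *v w"] A' by (simp add: B matrix_vector_mul_assoc)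
    have "?u $ 0 = 0" using *[of "axis 1 1"] by (simp add: axis_def)
    moreover have "?u $ 1 = 0" using *[of "axis 0 1"] by (simp add: axis_def)
    moreover have "?u $ 2 = 0" using *[of "axis 3 1"] by (simp add: axis_def)
    moreover have "?u $ 3 = 0" using *[of "axis 2 1"] by (simp add: axis_def)
    moreover have "?u $ 4 = 0" using *[of "axis 5 1"] by (simp add: axis_def)
    moreover have "?u $ 5 = 0" using *[of "axis 4 1"] by (simp add: axis_def)
    moreover have "?u $ 6 = 0" using *[of "axis 7 1"] by (simp add: axis_def)
    moreover have "?u $ 7 = 0" using *[of "axis 6 1"] by (simp add: axis_def)
    moreover have "i \<in> {0, 1, 2, 3, 4, 5, 6, 7}" for i :: 8
    proof -
      have "card {0, 1, 2, 3, 4, 5, 6, 7 :: 8} = CARD(8)" by simp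
      then have "{0, 1, 2, 3, 4, 5, 6, 7 :: 8} = UNIV"
        by (intro card_subset_eq) simp_all
      then show ?thesis by blast
    qed
    ultimately have "?u = 0"
      by (simp add: vec_eq_iff) (metis empty_iff insertE)
    then have "A' *v ?u = 0" by simp
    then show "v = 0" using A' by (simp add: matrix_vector_mul_assoc)
  qed
qed

lemma B_add_right: "B u (v + w) = B u v + B u w"
  using B_add_left[of v w u] by (simp add: B_commute)

lemma B_scale_right: "B u (c *s v) = c * B u v"
  using B_scale_left[of c v u] by (simp add: B_commute)

lemma Q_zero [simp]: "Q 0 = 0"
  using Q_scale[of 0 0] by simp

lemma B_zero [simp]: "B 0 v = 0" "B v 0 = 0"
  by (simp_all add: B_def)

section \<open>Orthogonal complements with respect to the polar form\<close>

definition perp :: "('a^8) set \<Rightarrow> ('a^8) set" where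
  "perp S = {v. \<forall>u\<in>S. B u v = 0}"

lemma perpD: "v \<in> perp S \<Longrightarrow> u \<in> S \<Longrightarrow> B u v = 0" "v \<in> perp S \<Longrightarrow> u \<in> S \<Longrightarrow> B v u = 0"
  by (auto simp: perp_def B_commute)

lemma perpI: "(\<And>u. u \<in> S \<Longrightarrow> B u v = 0) \<Longrightarrow> v \<in> perp S"
  by (auto simp: perp_def)

lemma perp_antimono: "S \<subseteq> T \<Longrightarrow> perp T \<subseteq> perp S"
  by (auto simp: perp_def)

lemma subspace_perp [simp]: "vec.subspace (perp S)"
  by (auto simp: vec.subspace_def perp_def B_add_right B_scale_right)

lemma perp_span: "perp (vec.span S) = perp S"
proof
  show "perp (vec.span S) \<subseteq> perp S"
    by (simp add: perp_antimono vec.span_superset)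
  show "perp S \<subseteq> perp (vec.span S)"
  proof
    fix v assume v: "v \<in> perp S"
    have "S \<subseteq> perp {v}" using v by (auto simp: perp_def B_commute)
    then have "vec.span S \<subseteq> perp {v}" by (rule vec.span_minimal) simp
    then show "v \<in> perp (vec.span S)" by (auto simp: perp_def B_commute)
  qed
qed

lemma perp_join:
  assumes "vec.subspace U" "vec.subspace W"
  shows "perp (join U W) = perp U \<inter> perp W"
proof
  show "perp (join U W) \<subseteq> perp U \<inter> perp W"
    using join_upper1[OF assms(2), of U] join_upper2[OF assms(1), of W] perp_antimono by blast
  show "perp U \<inter> perp W \<subseteq> perp (join U W)"
    by (auto simp: perp_def B_add_left elim!: joinE)
qed

lemma dim_meet_perp_singleton:
  assumes W: "vec.subspace W" and w: "w \<in> W" "B v w \<noteq> 0"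
  shows "vec.dim W = Suc (vec.dim (W \<inter> perp {v}))"
proof -
  have "W \<inter> perp {v} = {u\<in>W. B v u = 0}" by (auto simp: perp_def)
  then show ?thesis
    using dim_kernel[where f = "B v", OF W B_add_right B_scale_right w] by simp
qed

lemma dim_meet_perp_singleton_le:
  assumes W: "vec.subspace W"
  shows "vec.dim W \<le> Suc (vec.dim (W \<inter> perp {v}))"
proof (cases "\<exists>w\<in>W. B v w \<noteq> 0")
  case True
  then show ?thesis using dim_meet_perp_singleton[OF W] by auto
next
  case False
  then have "W \<inter> perp {v} = W" by (auto simp: perp_def)
  then show ?thesis by simp
qed

lemma dim_perp_span_insert:
  "vec.dim (perp U) \<le> Suc (vec.dim (perp (vec.span (insert a U))))"
proof -
  have "perp (vec.span (insert a U)) = perp U \<inter> perp {a}"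
    unfolding perp_span by (auto simp: perp_def)
  then show ?thesis using dim_meet_perp_singleton_le[of "perp U" a] by simp
qed

lemma dim_UNIV_8: "vec.dim (UNIV :: ('a^8) set) = 8"
  unfolding vec_dim_card by simp

lemma dim_le_8: "vec.dim (U :: ('a^8) set) \<le> 8"
  using vec.dim_subset[of U UNIV] dim_UNIV_8 by simp

text \<open>Induction on the codimension, starting at the whole space, where nondegeneracy makes the
  complement trivial. Adding one vector to \<open>U\<close> costs \<open>perp U\<close> at most one
  dimension.\<close>

lemma dim_perp_le: "vec.subspace U \<Longrightarrow> vec.dim U + vec.dim (perp U) \<le> 8"
proof (induction "8 - vec.dim U" arbitrary: U)
  case 0
  then have "U = UNIV"
    using eq_of_dim_le[of U UNIV] dim_UNIV_8 by simp
  then have "perp U = {0}"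
    using B_nondegenerate by (auto simp: perp_def B_commute)
  then show ?case using dim_le_8[of U] by simp
next
  case (Suc n)
  then have "U \<noteq> UNIV" using dim_UNIV_8 by auto
  then obtain a where a: "a \<notin> U" by auto
  let ?U' = "vec.span (insert a U)"
  have "vec.dim ?U' = Suc (vec.dim U)" using dim_span_insert a Suc.prems by blast
  moreover from this have "vec.dim ?U' + vec.dim (perp ?U') \<le> 8"
    using Suc.hyps by (intro Suc.hyps(1)) simp_all
  ultimately show ?case using dim_perp_span_insert[of U a] by linarith
qed

text \<open>The same one-step estimate used upwards along a basis, starting at the zero space, whose
  complement is everything.\<close>

lemma dim_perp_ge: "vec.subspace U \<Longrightarrow> vec.dim U + vec.dim (perp U) \<ge> 8"
proof -
  have "vec.dim (vec.span S) + vec.dim (perp (vec.span S)) \<ge> 8"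
    if "finite S" "vec.independent S" for S
    using that
  proof (induction S)
    case empty
    have "perp (vec.span {}) = UNIV" by (simp add: perp_def)
    then show ?case using dim_UNIV_8 by simp
  next
    case (insert a S)
    then have ih: "8 \<le> vec.dim (vec.span S) + vec.dim (perp (vec.span S))"
      and a: "a \<notin> vec.span S"
      by (auto simp: vec.independent_insert)
    then have "vec.dim (vec.span (insert a S)) = Suc (vec.dim (vec.span S))"
      by (simp add: vec.dim_insert)
    then show ?case using ih dim_perp_span_insert[of "vec.span S" a] by (simp add: span_insert_span)
  qed
  moreover assume "vec.subspace U"
  moreover obtain S where "S \<subseteq> U" "vec.independent S" "U \<subseteq> vec.span S"
    using vec.basis_exists by metis
  ultimately show ?thesis
    using vec.span_subspace vec.finiteI_independent by metis
qed

lemma dim_perp: "vec.subspace U \<Longrightarrow> vec.dim U + vec.dim (perp U) = 8"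
  using dim_perp_le dim_perp_ge le_antisym by blast

section \<open>Totally singular subspaces and generators\<close>

lemma on_quadric_subspace: "on_quadric Q U \<Longrightarrow> vec.subspace U"
  by (simp add: on_quadric_def)

lemma on_quadric_Q: "on_quadric Q U \<Longrightarrow> v \<in> U \<Longrightarrow> Q v = 0"
  by (simp add: on_quadric_def)

lemma on_quadric_B: "on_quadric Q U \<Longrightarrow> u \<in> U \<Longrightarrow> v \<in> U \<Longrightarrow> B u v = 0"
  by (simp add: on_quadric_def B_def vec.subspace_add)

lemma on_quadric_perp: "on_quadric Q U \<Longrightarrow> U \<subseteq> perp U"
  by (auto simp: perp_def on_quadric_B)

lemma on_quadric_subset: "on_quadric Q U \<Longrightarrow> vec.subspace W \<Longrightarrow> W \<subseteq> U \<Longrightarrow> on_quadric Q W"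
  by (auto simp: on_quadric_def)

lemma on_quadric_Int: "on_quadric Q U \<Longrightarrow> vec.subspace W \<Longrightarrow> on_quadric Q (U \<inter> W)"
  by (auto simp: on_quadric_def vec.subspace_inter)

lemma on_quadric_join:
  assumes "on_quadric Q U" "on_quadric Q W" "W \<subseteq> perp U"
  shows "on_quadric Q (join U W)"
  unfolding on_quadric_def
proof (intro conjI ballI)
  show "vec.subspace (join U W)" using assms by (simp add: subspace_join on_quadric_subspace)
  fix v assume "v \<in> join U W"
  then obtain u w where "u \<in> U" "w \<in> W" "v = u + w" by blast
  then show "Q v = 0" using assms by (auto simp: Q_add on_quadric_Q dest: perpD)
qed

lemma on_quadric_span_singleton: "Q v = 0 \<Longrightarrow> on_quadric Q (vec.span {v})"
  unfolding on_quadric_def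
  by (rule conjI, rule vec.subspace_span) (auto simp: vec.span_singleton Q_scale)

lemma on_quadric_span_insert:
  assumes "on_quadric Q U" "Q v = 0" "v \<in> perp U"
  shows "on_quadric Q (vec.span (insert v U))"
proof -
  have "vec.span {v} \<subseteq> perp U" using assms(3) by (intro vec.span_minimal) auto
  then show ?thesis
    using on_quadric_join[OF assms(1) on_quadric_span_singleton[OF assms(2)]]
      join_span_singleton[of U v] on_quadric_subspace[OF assms(1)] by simp
qed

lemma on_quadric_span_pair:
  assumes "Q a = 0" "Q b = 0" "B a b = 0"
  shows "on_quadric Q (vec.span {a, b})"
proof -
  have "a \<in> perp (vec.span {b})"
    unfolding perp_span using assms by (simp add: perp_def B_commute)
  then show ?thesis
    using on_quadric_span_insert[OF on_quadric_span_singleton[OF assms(2)] assms(1)]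
    by (simp add: span_insert_span)
qed

lemma on_quadric_dim_le: "on_quadric Q U \<Longrightarrow> vec.dim U \<le> 4"
  using dim_perp[of U] vec.dim_subset[OF on_quadric_perp, of U] on_quadric_subspace by force

abbreviation gens :: "('a^8) set set" where "gens \<equiv> generators Q"

lemma gens_iff: "\<pi> \<in> gens \<longleftrightarrow> on_quadric Q \<pi> \<and> vec.dim \<pi> = 4"
  by (auto simp: generators_def proj_dim_def)

lemma gens_on_quadric: "\<pi> \<in> gens \<Longrightarrow> on_quadric Q \<pi>"
  and gens_dim: "\<pi> \<in> gens \<Longrightarrow> vec.dim \<pi> = 4"
  and gens_subspace: "\<pi> \<in> gens \<Longrightarrow> vec.subspace \<pi>"
  by (auto simp: gens_iff on_quadric_def)

lemma gens_perp: "\<pi> \<in> gens \<Longrightarrow> perp \<pi> = \<pi>"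
  using eq_of_dim_le[of \<pi> "perp \<pi>"] dim_perp[of \<pi>] on_quadric_perp[of \<pi>]
  by (simp add: gens_iff on_quadric_subspace)

lemma gens_Int_subspace: "\<pi> \<in> gens \<Longrightarrow> \<tau> \<in> gens \<Longrightarrow> vec.subspace (\<pi> \<inter> \<tau>)"
  by (simp add: gens_subspace vec.subspace_inter)

lemma gens_Int_on_quadric: "\<pi> \<in> gens \<Longrightarrow> \<tau> \<in> gens \<Longrightarrow> on_quadric Q (\<pi> \<inter> \<tau>)"
  by (simp add: gens_subspace gens_on_quadric on_quadric_Int)

lemma gens_eqI: "\<pi> \<in> gens \<Longrightarrow> \<tau> \<in> gens \<Longrightarrow> vec.dim (\<pi> \<inter> \<tau>) \<ge> 4 \<Longrightarrow> \<pi> = \<tau>"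
  using eq_of_dim_le[of "\<pi> \<inter> \<tau>" \<pi>] eq_of_dim_le[of "\<pi> \<inter> \<tau>" \<tau>]
  by (auto simp: gens_subspace gens_dim gens_Int_subspace)

text \<open>Since \<open>perp \<tau> = \<tau>\<close>, the space
  \<open>\<tau> \<inter> perp U\<close> is the complement of \<open>join \<tau> U\<close>, so both
  dimension formulas apply.\<close>

lemma dim_gen_meet_perp:
  assumes "\<tau> \<in> gens" "vec.subspace U"
  shows "vec.dim (\<tau> \<inter> perp U) + vec.dim U = 4 + vec.dim (\<tau> \<inter> U)"
  using dim_perp[OF subspace_join[of \<tau> U]] perp_join[of \<tau> U] dim_join[of \<tau> U] assms
  by (simp add: gens_subspace gens_perp gens_dim)

text \<open>The projection of \<open>\<tau>\<close> from \<open>U\<close>: cutting with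
  \<open>perp U\<close> loses dim U - dim (\<tau> \<inter> U) dimensions, and adding
  \<open>U\<close> restores exactly as many.\<close>

lemma gen_through:
  assumes U: "on_quadric Q U" and \<tau>: "\<tau> \<in> gens"
  shows "join U (\<tau> \<inter> perp U) \<in> gens"
proof -
  have "U \<inter> (\<tau> \<inter> perp U) = \<tau> \<inter> U" using on_quadric_perp[OF U] by auto
  then have "vec.dim (join U (\<tau> \<inter> perp U)) + vec.dim (\<tau> \<inter> U) = vec.dim U + vec.dim (\<tau> \<inter> perp U)"
    using dim_join[of U "\<tau> \<inter> perp U"] U \<tau>
    by (simp add: on_quadric_subspace gens_subspace vec.subspace_inter)
  then have "vec.dim (join U (\<tau> \<inter> perp U)) = 4"
    using dim_gen_meet_perp[OF \<tau> on_quadric_subspace[OF U]] by simp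
  moreover have "on_quadric Q (join U (\<tau> \<inter> perp U))"
    by (rule on_quadric_join[OF U on_quadric_Int]) (use \<tau> in \<open>auto simp: gens_on_quadric\<close>)
  ultimately show ?thesis by (simp add: gens_iff)
qed

text \<open>By dimension the complement of the common plane is \<open>join \<pi> \<pi>'\<close>. For
  v = a + b with a in \<pi> and b in \<pi>', the value of \<open>Q\<close> is \<open>B a b\<close>.
  If this vanishes and \<open>a\<close> is outside \<pi>', then \<open>a\<close> and the plane span
  \<pi>, so \<open>b\<close> is perpendicular to \<pi> and hence lies in it.\<close>

lemma singular_in_perp_plane:
  assumes \<pi>: "\<pi> \<in> gens" and \<pi>': "\<pi>' \<in> gens" and dim: "vec.dim (\<pi> \<inter> \<pi>') = 3"
    and v: "v \<in> perp (\<pi> \<inter> \<pi>')" "Q v = 0"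
  shows "v \<in> \<pi> \<or> v \<in> \<pi>'"
proof -
  note sub = gens_subspace[OF \<pi>] gens_subspace[OF \<pi>'] gens_Int_subspace[OF \<pi> \<pi>']
  have "join \<pi> \<pi>' = perp (\<pi> \<inter> \<pi>')"
  proof (rule eq_of_dim_le)
    show "join \<pi> \<pi>' \<subseteq> perp (\<pi> \<inter> \<pi>')"
      using gens_perp[OF \<pi>] gens_perp[OF \<pi>'] perp_antimono
      by (intro join_least subspace_perp) blast+
    show "vec.dim (perp (\<pi> \<inter> \<pi>')) \<le> vec.dim (join \<pi> \<pi>')"
      using dim_join[OF sub(1,2)] dim_perp[OF sub(3)] dim \<pi> \<pi>' by (simp add: gens_dim)
  qed (use sub in \<open>simp_all add: subspace_join\<close>)
  then obtain a b where a: "a \<in> \<pi>" and b: "b \<in> \<pi>'" and ab: "v = a + b" using v by blast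
  have Bab: "B a b = 0"
    using v(2) a b \<pi> \<pi>' by (simp add: ab Q_add on_quadric_Q[OF gens_on_quadric])
  show ?thesis
  proof (cases "a \<in> \<pi>'")
    case True
    then show ?thesis using b sub by (simp add: ab vec.subspace_add)
  next
    case False
    have "vec.span (insert a (\<pi> \<inter> \<pi>')) = \<pi>"
    proof (rule eq_of_dim_le)
      show "vec.span (insert a (\<pi> \<inter> \<pi>')) \<subseteq> \<pi>" using a sub by (intro vec.span_minimal) auto
      show "vec.dim \<pi> \<le> vec.dim (vec.span (insert a (\<pi> \<inter> \<pi>')))"
        using dim_span_insert[OF sub(3), of a] False dim \<pi> by (simp add: gens_dim)
    qed (use sub in simp_all)
    moreover have "b \<in> perp (insert a (\<pi> \<inter> \<pi>'))"
      using Bab b \<pi>' by (auto simp: perp_def on_quadric_B[OF gens_on_quadric])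
    ultimately have "b \<in> perp \<pi>" using perp_span by metis
    then show ?thesis using a sub \<pi> by (simp add: ab gens_perp vec.subspace_add)
  qed
qed

text \<open>Put E = \<pi> \<inter> \<pi>'. The singular vectors perpendicular to \<open>E\<close>
  are covered by \<pi> and \<pi>', and a subspace covered by two subspaces lies in one of them. So
  one of the two generators meets \<tau> in \<tau> \<inter> perp E and the other only in \<tau>
  \<inter> E, one dimension less.\<close>

lemma adjacent_dim:
  assumes \<pi>: "\<pi> \<in> gens" and \<pi>': "\<pi>' \<in> gens" and dim: "vec.dim (\<pi> \<inter> \<pi>') = 3" and \<tau>: "\<tau> \<in> gens"
  shows "vec.dim (\<pi> \<inter> \<tau>) = Suc (vec.dim (\<pi>' \<inter> \<tau>)) \<or> vec.dim (\<pi>' \<inter> \<tau>) = Suc (vec.dim (\<pi> \<inter> \<tau>))"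
proof -
  let ?E = "\<pi> \<inter> \<pi>'"
  have *: "vec.dim (\<sigma> \<inter> \<tau>) = Suc (vec.dim (\<sigma>' \<inter> \<tau>))"
    if \<sigma>: "\<sigma> \<in> gens" and \<sigma>': "\<sigma>' \<in> gens" and E: "\<sigma> \<inter> \<sigma>' = ?E" and sub: "\<tau> \<inter> perp ?E \<subseteq> \<sigma>"
    for \<sigma> \<sigma>'
  proof -
    have "\<sigma> \<subseteq> perp ?E" "\<sigma>' \<subseteq> perp ?E"
      using gens_perp[OF \<sigma>] gens_perp[OF \<sigma>'] perp_antimono[of ?E] E by blast+
    then have "\<sigma> \<inter> \<tau> = \<tau> \<inter> perp ?E" "\<sigma>' \<inter> \<tau> = \<tau> \<inter> ?E" using sub E by blast+
    then show ?thesis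
      using dim_gen_meet_perp[OF \<tau> gens_Int_subspace[OF \<pi> \<pi>']] dim by simp
  qed
  have "\<tau> \<inter> perp ?E \<subseteq> \<pi> \<or> \<tau> \<inter> perp ?E \<subseteq> \<pi>'"
  proof (rule ccontr)
    assume "\<not> ?thesis"
    then obtain u v where u: "u \<in> \<tau> \<inter> perp ?E" "u \<notin> \<pi>" and v: "v \<in> \<tau> \<inter> perp ?E" "v \<notin> \<pi>'" by blast
    have sing: "w \<in> \<pi> \<or> w \<in> \<pi>'" if "w \<in> \<tau> \<inter> perp ?E" for w
      using singular_in_perp_plane[OF \<pi> \<pi>' dim, of w] that \<tau> by (auto simp: on_quadric_Q[OF gens_on_quadric])
    have uv: "u \<in> \<pi>'" "v \<in> \<pi>" using sing u v by blast+
    have "u + v \<in> \<tau> \<inter> perp ?E"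
      using u v \<tau> by (simp add: vec.subspace_add gens_subspace)
    then consider "u + v \<in> \<pi>" | "u + v \<in> \<pi>'" using sing by blast
    then show False
    proof cases
      case 1
      then have "u + v - v \<in> \<pi>" using uv \<pi> by (intro vec.subspace_diff gens_subspace)
      then show False using u by simp
    next
      case 2
      then have "u + v - u \<in> \<pi>'" using uv \<pi>' by (intro vec.subspace_diff gens_subspace)
      then show False using v by simp
    qed
  qed
  then show ?thesis using *[OF \<pi> \<pi>'] *[OF \<pi>' \<pi>] by blast
qed

text \<open>Replacing \<open>\<pi>\<close> by a generator one step closer to \<open>\<tau>\<close> changes the dimensions of the
  intersections with \<open>\<tau>\<close> and with \<open>\<sigma>\<close> by exactly one.\<close>

lemma parity:
  assumes \<pi>: "\<pi> \<in> gens" and \<tau>: "\<tau> \<in> gens" and \<sigma>: "\<sigma> \<in> gens"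
  shows "even (vec.dim (\<pi> \<inter> \<tau>) + vec.dim (\<tau> \<inter> \<sigma>) + vec.dim (\<pi> \<inter> \<sigma>))"
  using \<pi>
proof (induction "4 - vec.dim (\<pi> \<inter> \<tau>)" arbitrary: \<pi>)
  case 0
  then have "\<pi> = \<tau>" using \<tau> gens_eqI[of \<pi> \<tau>] by simp
  then show ?case using \<tau> gens_dim[of \<tau>] by simp
next
  case (Suc n)
  note sub = gens_subspace[OF Suc.prems] gens_subspace[OF \<tau>]
  have "\<not> \<tau> \<subseteq> \<pi>"
  proof
    assume "\<tau> \<subseteq> \<pi>"
    then have "vec.dim (\<pi> \<inter> \<tau>) = 4" using \<tau> by (simp add: gens_dim Int_absorb1)
    then show False using Suc.hyps by simp
  qed
  then obtain t where t: "t \<in> \<tau>" "t \<notin> \<pi>" by blast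
  \<comment> \<open>The neighbour \<open>?\<pi>'\<close> of \<pi> through \<open>t\<close> keeps
    \<pi> \<inter> \<tau>, all of which is perpendicular to \<open>t\<close>, and gains
    \<open>t\<close>.\<close>
  let ?E = "\<pi> \<inter> perp {t}" and ?\<pi>' = "vec.span (insert t (\<pi> \<inter> perp {t}))"
  have E: "vec.subspace ?E" using sub by (simp add: vec.subspace_inter)
  have "t \<notin> perp \<pi>" using t Suc.prems by (simp add: gens_perp)
  then obtain w where "w \<in> \<pi>" "B t w \<noteq> 0" by (auto simp: perp_def B_commute)
  then have dimE: "vec.dim ?E = 3"
    using dim_meet_perp_singleton[OF sub(1), of w t] Suc.prems by (simp add: gens_dim)
  have "on_quadric Q ?\<pi>'"
  proof (rule on_quadric_span_insert)
    show "on_quadric Q ?E" using Suc.prems by (simp add: gens_on_quadric on_quadric_Int)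
    show "Q t = 0" using t \<tau> by (simp add: on_quadric_Q[OF gens_on_quadric])
    show "t \<in> perp ?E" by (auto simp: perp_def B_commute)
  qed
  moreover have "vec.dim ?\<pi>' = 4" using dim_span_insert[OF E, of t] t dimE by simp
  ultimately have \<pi>': "?\<pi>' \<in> gens" by (simp add: gens_iff)
  have "?E \<subseteq> \<pi> \<inter> ?\<pi>'" using vec.span_superset[of "insert t ?E"] by blast
  then have "vec.dim (\<pi> \<inter> ?\<pi>') \<ge> 3" using vec.dim_subset[of ?E "\<pi> \<inter> ?\<pi>'"] dimE by simp
  moreover have "\<pi> \<noteq> ?\<pi>'" using t vec.span_base[of t "insert t ?E"] by blast
  ultimately have adj: "vec.dim (\<pi> \<inter> ?\<pi>') = 3"
    using gens_eqI[OF Suc.prems \<pi>'] by (cases "vec.dim (\<pi> \<inter> ?\<pi>') \<ge> 4") auto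
  have "\<pi> \<inter> \<tau> \<subseteq> ?\<pi>'"
  proof
    fix v assume v: "v \<in> \<pi> \<inter> \<tau>"
    then have "v \<in> ?E" using t \<tau> by (auto simp: perp_def on_quadric_B[OF gens_on_quadric])
    then show "v \<in> ?\<pi>'" by (simp add: vec.span_base)
  qed
  then have "vec.dim (?\<pi>' \<inter> \<tau>) \<ge> vec.dim (\<pi> \<inter> \<tau>)" by (intro vec.dim_subset) auto
  then have eq: "vec.dim (?\<pi>' \<inter> \<tau>) = Suc (vec.dim (\<pi> \<inter> \<tau>))"
    using adjacent_dim[OF Suc.prems \<pi>' adj \<tau>] by simp
  have "n = 4 - vec.dim (?\<pi>' \<inter> \<tau>)" using Suc.hyps(2) eq by simp
  from Suc.hyps(1)[OF this \<pi>'] show ?case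
    using eq adjacent_dim[OF Suc.prems \<pi>' adj \<sigma>] by auto
qed

text \<open>If \<open>v \<in> E\<^sup>\<bottom> - \<pi>\<close> and \<open>e \<in> \<pi>\<close> with \<open>B e v \<noteq> 0\<close>, then \<open>v - (Q v / B e v) e\<close> is singular.\<close>

lemma other_gen_through_plane:
  assumes \<pi>: "\<pi> \<in> gens" and E: "vec.subspace E" "E \<subseteq> \<pi>" "vec.dim E = 3"
  obtains \<sigma> where "\<sigma> \<in> gens" "\<sigma> \<inter> \<pi> = E"
proof -
  have "vec.dim (perp E) = 5" using dim_perp[OF E(1)] E(3) by simp
  then have "\<not> perp E \<subseteq> \<pi>" using vec.dim_subset[of "perp E" \<pi>] gens_dim[OF \<pi>] by auto
  then obtain v where v: "v \<in> perp E" "v \<notin> \<pi>" by blast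
  then have "v \<notin> perp \<pi>" using \<pi> by (simp add: gens_perp)
  then obtain e where e: "e \<in> \<pi>" "B e v \<noteq> 0" by (auto simp: perp_def)
  define u where "u = v + (- (Q v / B e v)) *s e"
  have "Q u = Q v + (- (Q v / B e v)) * B e v"
    unfolding u_def Q_add B_scale_right Q_scale
    using e \<pi> by (simp add: on_quadric_Q[OF gens_on_quadric] B_commute)
  then have Qu: "Q u = 0" using e by simp
  have "e \<in> perp E" using e E(2) \<pi> by (auto intro!: perpI on_quadric_B[OF gens_on_quadric])
  then have uE: "u \<in> perp E"
    unfolding u_def using v by (intro vec.subspace_add vec.subspace_scale) auto
  have un: "u \<notin> \<pi>"
  proof
    assume "u \<in> \<pi>"
    then have "u - (- (Q v / B e v)) *s e \<in> \<pi>"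
      using e gens_subspace[OF \<pi>] by (intro vec.subspace_diff vec.subspace_scale)
    then show False using v by (simp add: u_def)
  qed
  let ?\<sigma> = "vec.span (insert u E)"
  have "on_quadric Q ?\<sigma>"
    using on_quadric_subset[OF gens_on_quadric[OF \<pi>] E(1,2)] Qu uE by (rule on_quadric_span_insert)
  moreover have "vec.dim ?\<sigma> = 4" using dim_span_insert[OF E(1), of u] un E by auto
  ultimately have \<sigma>: "?\<sigma> \<in> gens" by (simp add: gens_iff)
  have "?\<sigma> \<noteq> \<pi>" using un vec.span_base[of u "insert u E"] by blast
  then have "vec.dim (?\<sigma> \<inter> \<pi>) \<le> 3" using gens_eqI[OF \<sigma> \<pi>] by linarith
  moreover have "E \<subseteq> ?\<sigma> \<inter> \<pi>" using E vec.span_superset[of "insert u E"] by blast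
  ultimately have "E = ?\<sigma> \<inter> \<pi>"
    using E gens_Int_subspace[OF \<sigma> \<pi>] by (intro eq_of_dim_le) auto
  then show ?thesis using that[OF \<sigma>] by simp
qed

lemma subspace_between:
  fixes U W :: "('a^8) set"
  assumes "vec.subspace U" "vec.subspace W" "U \<subseteq> W" "vec.dim U \<le> n" "n \<le> vec.dim W"
  obtains E where "vec.subspace E" "U \<subseteq> E" "E \<subseteq> W" "vec.dim E = n"
proof -
  have "\<exists>E. vec.subspace E \<and> U \<subseteq> E \<and> E \<subseteq> W \<and> vec.dim E = n"
    using assms(4,5)
  proof (induction n rule: dec_induct)
    case base
    then show ?case using assms by blast
  next
    case (step n)
    then obtain E where E: "vec.subspace E" "U \<subseteq> E" "E \<subseteq> W" "vec.dim E = n" by auto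
    then have "E \<noteq> W" using step.prems by auto
    then obtain a where a: "a \<in> W" "a \<notin> E" using E by blast
    have "vec.span (insert a E) \<subseteq> W" using a E assms by (intro vec.span_minimal) auto
    moreover have "U \<subseteq> vec.span (insert a E)" using E vec.span_superset[of "insert a E"] by blast
    ultimately show ?case using dim_span_insert[OF E(1) a(2)] E(4) by blast
  qed
  then show ?thesis using that by blast
qed

end

section \<open>The two classes of generators\<close>

locale generator_class = hyperbolic_space +
  fixes P
  assumes P_class: "P \<in> generator_classes Q"
begin

lemma P_gens: "\<pi> \<in> P \<Longrightarrow> \<pi> \<in> gens"
  using P_class by (auto simp: generator_classes_def same_class_def elim!: quotientE)

lemma P_base:
  obtains \<pi>\<^sub>0 where "\<pi>\<^sub>0 \<in> gens" "\<And>\<tau>. \<tau> \<in> gens \<Longrightarrow> \<tau> \<in> P \<longleftrightarrow> even (vec.dim (\<pi>\<^sub>0 \<inter> \<tau>))"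
proof -
  \<comment> \<open>Projective dimension is one less than vector dimension, so odd turns into even;
    the empty subspace, of dimension -1, is covered.\<close>
  have odd: "odd (int n - 1) \<longleftrightarrow> even n" for n by simp
  obtain \<pi>\<^sub>0 where "\<pi>\<^sub>0 \<in> gens" "P = same_class Q `` {\<pi>\<^sub>0}"
    using P_class by (auto simp: generator_classes_def elim!: quotientE)
  then show ?thesis using that[of \<pi>\<^sub>0] by (simp add: same_class_def proj_dim_def odd)
qed

text \<open>All three are \<open>parity\<close> with the representative \<open>\<pi>\<^sub>0\<close>
  as third generator. The last one says that the generators outside \<open>P\<close> form a single
  class.\<close>

lemma even_dim_P: "\<pi> \<in> P \<Longrightarrow> \<tau> \<in> P \<Longrightarrow> even (vec.dim (\<pi> \<inter> \<tau>))"
  and odd_dim_P: "\<pi> \<in> P \<Longrightarrow> \<sigma> \<in> gens - P \<Longrightarrow> odd (vec.dim (\<pi> \<inter> \<sigma>))"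
  and even_dim_notP: "\<sigma> \<in> gens - P \<Longrightarrow> \<sigma>' \<in> gens - P \<Longrightarrow> even (vec.dim (\<sigma> \<inter> \<sigma>'))"
proof -
  obtain \<pi>\<^sub>0 where \<pi>\<^sub>0: "\<pi>\<^sub>0 \<in> gens" "\<And>\<tau>. \<tau> \<in> gens \<Longrightarrow> \<tau> \<in> P \<longleftrightarrow> even (vec.dim (\<pi>\<^sub>0 \<inter> \<tau>))"
    using P_base by blast
  note par = parity[OF \<pi>\<^sub>0(1)]
  show "even (vec.dim (\<pi> \<inter> \<tau>))" if "\<pi> \<in> P" "\<tau> \<in> P"
    using par[of \<pi> \<tau>] \<pi>\<^sub>0(2) that P_gens by auto
  show "odd (vec.dim (\<pi> \<inter> \<sigma>))" if "\<pi> \<in> P" "\<sigma> \<in> gens - P"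
    using par[of \<pi> \<sigma>] \<pi>\<^sub>0(2) that P_gens by auto
  show "even (vec.dim (\<sigma> \<inter> \<sigma>'))" if "\<sigma> \<in> gens - P" "\<sigma>' \<in> gens - P"
    using par[of \<sigma> \<sigma>'] \<pi>\<^sub>0(2) that by auto
qed

lemma P_memI:
  assumes "\<pi> \<in> P" "\<tau> \<in> gens" "even (vec.dim (\<pi> \<inter> \<tau>))" shows "\<tau> \<in> P"
  using odd_dim_P[of \<pi> \<tau>] assms by blast

lemma not_P_memI:
  assumes "\<pi> \<in> P" "\<tau> \<in> gens" "odd (vec.dim (\<pi> \<inter> \<tau>))" shows "\<tau> \<in> gens - P"
  using even_dim_P[of \<pi> \<tau>] assms by blast

lemma P_memI_odd:
  assumes "\<sigma> \<in> gens - P" "\<tau> \<in> gens" "odd (vec.dim (\<sigma> \<inter> \<tau>))" shows "\<tau> \<in> P"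
  using even_dim_notP[of \<sigma> \<tau>] assms by blast

lemma P_nonempty: obtains \<pi> where "\<pi> \<in> P"
proof -
  obtain \<pi>\<^sub>0 where "\<pi>\<^sub>0 \<in> gens" "\<And>\<tau>. \<tau> \<in> gens \<Longrightarrow> \<tau> \<in> P \<longleftrightarrow> even (vec.dim (\<pi>\<^sub>0 \<inter> \<tau>))"
    using P_base by blast
  then have "\<pi>\<^sub>0 \<in> P" by (simp add: gens_dim)
  then show ?thesis using that by blast
qed

text \<open>The even dimensions up to 4 are 0, 2 and 4, and the two ends are the disjoint and the
  equal case.\<close>

lemma P_dim_cases:
  assumes "\<pi> \<in> P" "\<tau> \<in> P" "\<pi> \<noteq> \<tau>" "\<pi> \<inter> \<tau> \<noteq> {0}"
  shows "vec.dim (\<pi> \<inter> \<tau>) = 2"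
proof -
  have "vec.dim (\<pi> \<inter> \<tau>) < 4" using gens_eqI[of \<pi> \<tau>] assms P_gens by force
  moreover have "vec.dim (\<pi> \<inter> \<tau>) \<noteq> 0"
    using assms dim_zero_iff[OF gens_Int_subspace] P_gens by blast
  moreover have "even (vec.dim (\<pi> \<inter> \<tau>))" using even_dim_P assms by blast
  moreover have "n < 4 \<Longrightarrow> n \<noteq> 0 \<Longrightarrow> even n \<Longrightarrow> n = 2" for n :: nat by presburger
  ultimately show ?thesis by blast
qed

text \<open>Some generator passes through \<open>E\<close>, of unknown class. A second one meeting
  it exactly in \<open>E\<close> has an intersection of odd dimension with it and so belongs to the
  other class.\<close>

lemma gens_through_plane:
  assumes E: "on_quadric Q E" "vec.dim E = 3"
  obtains \<pi> \<sigma> where "\<pi> \<in> P" "\<sigma> \<in> gens - P" "E \<subseteq> \<pi>" "E \<subseteq> \<sigma>"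
proof -
  obtain \<pi>\<^sub>0 where "\<pi>\<^sub>0 \<in> P" by (rule P_nonempty)
  then have \<rho>: "join E (\<pi>\<^sub>0 \<inter> perp E) \<in> gens" (is "?\<rho> \<in> _")
    using gen_through[OF E(1)] P_gens by blast
  have E\<rho>: "E \<subseteq> ?\<rho>"
    using E by (intro join_upper1) (simp add: P_gens[OF \<open>\<pi>\<^sub>0 \<in> P\<close>] gens_subspace vec.subspace_inter)
  obtain \<rho>' where \<rho>': "\<rho>' \<in> gens" "\<rho>' \<inter> ?\<rho> = E"
    using other_gen_through_plane[OF \<rho> on_quadric_subspace[OF E(1)] E\<rho> E(2)] by blast
  then have sub: "E \<subseteq> \<rho>'" by blast
  have odd: "odd (vec.dim (?\<rho> \<inter> \<rho>'))" using \<rho>' E by (simp add: Int_commute)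
  show ?thesis
  proof (cases "?\<rho> \<in> P")
    case True
    then show ?thesis using not_P_memI[OF True \<rho>'(1) odd] that E\<rho> sub by blast
  next
    case False
    then show ?thesis using P_memI_odd[OF _ \<rho>'(1) odd] \<rho> that E\<rho> sub by blast
  qed
qed

lemma P_eqI:
  assumes "\<pi> \<in> P" "\<tau> \<in> P" "E \<subseteq> \<pi>" "E \<subseteq> \<tau>" "vec.dim E \<ge> 3" shows "\<pi> = \<tau>"
proof (rule ccontr)
  assume ne: "\<pi> \<noteq> \<tau>"
  have "vec.dim (\<pi> \<inter> \<tau>) \<ge> 3" using assms vec.dim_subset[of E "\<pi> \<inter> \<tau>"] by auto
  moreover from this have "\<pi> \<inter> \<tau> \<noteq> {0}" by auto
  ultimately show False using P_dim_cases[OF assms(1,2) ne] by simp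
qed

lemma not_P_eqI:
  assumes "\<pi> \<in> gens - P" "\<tau> \<in> gens - P" "E \<subseteq> \<pi>" "E \<subseteq> \<tau>" "vec.dim E \<ge> 3" shows "\<pi> = \<tau>"
proof -
  have "vec.dim (\<pi> \<inter> \<tau>) \<ge> 3" using assms vec.dim_subset[of E "\<pi> \<inter> \<tau>"] by auto
  moreover have "even (vec.dim (\<pi> \<inter> \<tau>))" using even_dim_notP assms by blast
  moreover have "n \<ge> 3 \<Longrightarrow> even n \<Longrightarrow> n \<ge> 4" for n :: nat by presburger
  ultimately have "vec.dim (\<pi> \<inter> \<tau>) \<ge> 4" by blast
  then show ?thesis using gens_eqI assms by blast
qed

lemma ex1_P_through_plane:
  assumes "on_quadric Q E" "vec.dim E = 3" shows "\<exists>!\<pi>. \<pi> \<in> P \<and> E \<subseteq> \<pi>"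
proof -
  obtain \<pi> \<sigma> where "\<pi> \<in> P" "\<sigma> \<in> gens - P" "E \<subseteq> \<pi>" "E \<subseteq> \<sigma>"
    by (rule gens_through_plane[OF assms])
  then show ?thesis using P_eqI[of _ _ E] assms by auto
qed

text \<open>The dimension is odd and at most 4, so a common line already forces a common plane.
  Membership in a base-solid is obtained this way from a single line.\<close>

lemma P_opposite_dim:
  assumes "\<pi> \<in> P" "\<sigma> \<in> gens - P" "vec.dim (\<pi> \<inter> \<sigma>) \<ge> 2" shows "vec.dim (\<pi> \<inter> \<sigma>) = 3"
proof -
  have "odd (vec.dim (\<pi> \<inter> \<sigma>))" using odd_dim_P assms by blast
  moreover have "vec.dim (\<pi> \<inter> \<sigma>) \<le> 4"
    using on_quadric_dim_le gens_Int_on_quadric assms P_gens by blast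
  moreover have "n \<ge> 2 \<Longrightarrow> n \<le> 4 \<Longrightarrow> odd n \<Longrightarrow> n = 3" for n :: nat by presburger
  ultimately show ?thesis using assms(3) by blast
qed

end

section \<open>Counting in a Cameron-Liebler set\<close>

context hyperbolic_space begin

lemma q_ge_2: "q \<ge> 2"
  using two_le_CARD[where 'a = 'a] by (simp add: q_eq)

lemma card_nonzero: "vec.subspace U \<Longrightarrow> real (card (U - {0 :: 'a^8})) = q ^ vec.dim U - 1"
  unfolding q_eq by (rule card_subspace_nonzero)

lemma card_diff:
  "vec.subspace U \<Longrightarrow> vec.subspace W \<Longrightarrow> W \<subseteq> U \<Longrightarrow>
    real (card (U - W :: ('a^8) set)) = q ^ vec.dim U - q ^ vec.dim W"
  unfolding q_eq by (rule card_subspace_diff)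

lemma card_units: "real (card (UNIV - {0 :: 'a})) = q - 1"
  using two_le_CARD[where 'a = 'a] by (simp add: q_eq card_Diff_singleton of_nat_diff)

section \<open>Singular lines joining two disjoint totally singular subspaces\<close>

definition sing_line :: "('a^8) set \<Rightarrow> bool" where
  "sing_line l \<longleftrightarrow> on_quadric Q l \<and> vec.dim l = 2"

lemma sing_lineD: "sing_line l \<Longrightarrow> on_quadric Q l" "sing_line l \<Longrightarrow> vec.dim l = 2"
    "sing_line l \<Longrightarrow> vec.subspace l"
  by (auto simp: sing_line_def on_quadric_def)

lemma sing_lineI: "\<pi> \<in> gens \<Longrightarrow> vec.subspace l \<Longrightarrow> l \<subseteq> \<pi> \<Longrightarrow> vec.dim l = 2 \<Longrightarrow> sing_line l"
  using on_quadric_subset[OF gens_on_quadric] by (simp add: sing_line_def)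

text \<open>For disjoint totally singular \<open>U\<close> and \<open>W\<close> the spans of these
  pairs are the singular lines joining a point of \<open>U\<close> to a point of \<open>W\<close>.
  Vectors are counted instead of points, so each line occurs with a multiplicity in q - 1.\<close>

definition perp_pairs :: "('a^8) set \<Rightarrow> ('a^8) set \<Rightarrow> (('a^8) \<times> ('a^8)) set" where
  "perp_pairs U W = {(a, b). a \<in> U - {0} \<and> b \<in> W - {0} \<and> B a b = 0}"

text \<open>As the sum of \<open>U\<close> and \<open>W\<close> is direct, the first entry must be
  one of the q - 1 nonzero multiples of \<open>v\<close>, while the second is any of the
  \<open>d\<close> vectors of \<open>W\<close> perpendicular to it.\<close>

lemma card_perp_pairs_span_left:
  assumes U: "on_quadric Q U" and W: "on_quadric Q W" and UW: "U \<inter> W = {0}"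
    and v: "v \<in> U - {0}" and d: "real (card {b\<in>W - {0}. B v b = 0}) = d"
  shows "real (card {z\<in>perp_pairs U W. v \<in> vec.span {fst z, snd z}}) = (q - 1) * d"
proof -
  note sub = on_quadric_subspace[OF U] on_quadric_subspace[OF W]
  let ?X = "(UNIV - {0 :: 'a}) \<times> {b\<in>W - {0}. B v b = 0}"
  let ?f = "\<lambda>(c, b). (c *s v, b)"
  have "{z\<in>perp_pairs U W. v \<in> vec.span {fst z, snd z}} = ?f ` ?X"
  proof (intro equalityI subsetI)
    fix z assume "z \<in> {z\<in>perp_pairs U W. v \<in> vec.span {fst z, snd z}}"
    then obtain a b where z: "z = (a, b)" "a \<in> U - {0}" "b \<in> W - {0}" "B a b = 0"
      and "v \<in> vec.span {a, b}"
      by (cases z) (auto simp: perp_pairs_def)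
    then obtain \<alpha> \<beta> where v': "v = \<alpha> *s a + \<beta> *s b" by (auto simp: in_span_pair)
    then have "v + 0 = \<alpha> *s a + \<beta> *s b" by simp
    then have "v = \<alpha> *s a"
      using direct_sum_unique(1)[OF sub UW, of v "\<alpha> *s a" 0 "\<beta> *s b"] v z sub
      by (auto simp: vec.subspace_scale vec.subspace_0)
    with v have "\<alpha> \<noteq> 0" "a = inverse \<alpha> *s v" by auto
    moreover have "B v b = 0" using z \<open>v = \<alpha> *s a\<close> by (simp add: B_scale_left)
    ultimately show "z \<in> ?f ` ?X"
      using z by (intro image_eqI[of _ _ "(inverse \<alpha>, b)"]) auto
  next
    fix z assume "z \<in> ?f ` ?X"
    then obtain c b where z: "z = (c *s v, b)" "c \<noteq> 0" "b \<in> W - {0}" "B v b = 0" by auto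
    then have "v = inverse c *s (c *s v) + 0 *s b" by simp
    then have "v \<in> vec.span {c *s v, b}" unfolding in_span_pair by blast
    then show "z \<in> {z\<in>perp_pairs U W. v \<in> vec.span {fst z, snd z}}"
      using z v sub by (auto simp: perp_pairs_def B_scale_left vec.subspace_scale)
  qed
  moreover have "inj_on ?f ?X"
    using v by (auto simp: inj_on_def)
  ultimately have "card {z\<in>perp_pairs U W. v \<in> vec.span {fst z, snd z}} = card ?X"
    by (simp add: card_image)
  then show ?thesis using d card_units by (simp add: card_cartesian_product)
qed

lemma perp_pairs_swap: "perp_pairs W U = prod.swap ` perp_pairs U W"
proof -
  have "prod.swap ` A = {(b, a). (a, b) \<in> A}" for A :: "(('a^8) \<times> ('a^8)) set" by force
  then show ?thesis unfolding perp_pairs_def by (auto simp: B_commute)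
qed

lemma card_perp_pairs_span_right:
  assumes U: "on_quadric Q U" and W: "on_quadric Q W" and UW: "U \<inter> W = {0}"
    and v: "v \<in> W - {0}" and d: "real (card {a\<in>U - {0}. B a v = 0}) = d"
  shows "real (card {z\<in>perp_pairs U W. v \<in> vec.span {fst z, snd z}}) = (q - 1) * d"
proof -
  have "{z\<in>perp_pairs W U. v \<in> vec.span {fst z, snd z}}
      = prod.swap ` {z\<in>perp_pairs U W. v \<in> vec.span {fst z, snd z}}"
    unfolding perp_pairs_swap[of W U] by (auto simp: insert_commute)
  then have "card {z\<in>perp_pairs W U. v \<in> vec.span {fst z, snd z}}
      = card {z\<in>perp_pairs U W. v \<in> vec.span {fst z, snd z}}"
    by (simp add: card_image)
  then show ?thesis
    using card_perp_pairs_span_left[OF W U, of v d] UW v d by (simp add: Int_commute B_commute)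
qed

text \<open>Write v = u + w. Directness forces the entries to be multiples of \<open>u\<close> and
  \<open>w\<close>, and these are perpendicular because Q v = B u w.\<close>

lemma card_perp_pairs_span_both:
  assumes U: "on_quadric Q U" and W: "on_quadric Q W" and UW: "U \<inter> W = {0}"
    and v: "v \<in> join U W" "Q v = 0" "v \<notin> U" "v \<notin> W"
  shows "real (card {z\<in>perp_pairs U W. v \<in> vec.span {fst z, snd z}}) = (q - 1)\<^sup>2"
proof -
  note sub = on_quadric_subspace[OF U] on_quadric_subspace[OF W]
  obtain u w where uw: "u \<in> U" "w \<in> W" "v = u + w" using v(1) by blast
  have nz: "u \<noteq> 0" "w \<noteq> 0" using uw v by auto
  have B0: "B u w = 0" using v(2) uw U W by (simp add: Q_add on_quadric_Q)
  let ?X = "(UNIV - {0 :: 'a}) \<times> (UNIV - {0 :: 'a})"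
  let ?f = "\<lambda>(c, d). (c *s u, d *s w)"
  have "{z\<in>perp_pairs U W. v \<in> vec.span {fst z, snd z}} = ?f ` ?X"
  proof (intro equalityI subsetI)
    fix z assume "z \<in> {z\<in>perp_pairs U W. v \<in> vec.span {fst z, snd z}}"
    then obtain a b where z: "z = (a, b)" "a \<in> U - {0}" "b \<in> W - {0}"
      and "v \<in> vec.span {a, b}"
      by (cases z) (auto simp: perp_pairs_def)
    then obtain \<alpha> \<beta> where "v = \<alpha> *s a + \<beta> *s b" by (auto simp: in_span_pair)
    then have eq: "u + w = \<alpha> *s a + \<beta> *s b" using uw by simp
    have "u = \<alpha> *s a" "w = \<beta> *s b"
      using direct_sum_unique[OF sub UW _ _ _ _ eq] uw z sub by (auto simp: vec.subspace_scale)
    with nz have "\<alpha> \<noteq> 0" "a = inverse \<alpha> *s u" "\<beta> \<noteq> 0" "b = inverse \<beta> *s w" by auto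
    then show "z \<in> ?f ` ?X"
      using z by (intro image_eqI[of _ _ "(inverse \<alpha>, inverse \<beta>)"]) auto
  next
    fix z assume "z \<in> ?f ` ?X"
    then obtain c d where z: "z = (c *s u, d *s w)" "c \<noteq> 0" "d \<noteq> 0" by auto
    then have "v = inverse c *s (c *s u) + inverse d *s (d *s w)" using uw by simp
    then have "v \<in> vec.span {c *s u, d *s w}" unfolding in_span_pair by blast
    then show "z \<in> {z\<in>perp_pairs U W. v \<in> vec.span {fst z, snd z}}"
      using z nz uw B0 sub
      by (auto simp: perp_pairs_def B_scale_left B_scale_right vec.subspace_scale)
  qed
  moreover have "inj_on ?f ?X" using nz by (auto simp: inj_on_def)
  ultimately have "card {z\<in>perp_pairs U W. v \<in> vec.span {fst z, snd z}} = card ?X"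
    by (simp add: card_image)
  then show ?thesis
    using card_units by (simp add: card_cartesian_product power2_eq_square)
qed

text \<open>Exchange the sums: a singular vector \<open>u + w\<close> lies in \<open>(q - 1)\<^sup>2\<close> of the spans if
  \<open>u\<close> and \<open>w\<close> are nonzero, and in \<open>(q - 1) d\<close> of them if one of the two vanishes.\<close>

lemma sum_perp_pairs_span:
  fixes g :: "'a^8 \<Rightarrow> real"
  assumes U: "on_quadric Q U" and W: "on_quadric Q W" and UW: "U \<inter> W = {0}"
    and dU: "\<And>a. a \<in> U - {0} \<Longrightarrow> real (card {b\<in>W - {0}. B a b = 0}) = d"
    and dW: "\<And>b. b \<in> W - {0} \<Longrightarrow> real (card {a\<in>U - {0}. B a b = 0}) = d"
  shows "(\<Sum>z\<in>perp_pairs U W. \<Sum>v\<in>vec.span {fst z, snd z} - {0}. g v) =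
    (q - 1)\<^sup>2 * ((\<Sum>v\<in>{v\<in>join U W. Q v = 0} - {0}. g v) - sum g (U - {0}) - sum g (W - {0}))
    + (q - 1) * d * (sum g (U - {0}) + sum g (W - {0}))"
proof -
  note sub = on_quadric_subspace[OF U] on_quadric_subspace[OF W]
  let ?S = "{v\<in>join U W. Q v = 0} - {0}"
  let ?UW = "(U - {0}) \<union> (W - {0})"
  let ?N = "\<lambda>v. real (card {z\<in>perp_pairs U W. v \<in> vec.span {fst z, snd z}})"
  have sub_S: "?UW \<subseteq> ?S"
    using U W join_upper1[OF sub(2), of U] join_upper2[OF sub(1), of W]
    unfolding on_quadric_def by blast
  \<comment> \<open>Each span consists of singular vectors of \<open>join U W\<close>, so an
    indicator makes the range of the inner sum independent of \<open>z\<close>.\<close>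
  have inner: "(\<Sum>v\<in>vec.span {fst z, snd z} - {0}. g v)
      = (\<Sum>v\<in>?S. g v * of_bool (v \<in> vec.span {fst z, snd z}))" if "z \<in> perp_pairs U W" for z
  proof -
    obtain a b where ab: "z = (a, b)" by (cases z)
    then have z: "z = (a, b)" "a \<in> U" "b \<in> W" "B a b = 0"
      using that by (auto simp: perp_pairs_def)
    have "vec.span {a, b} \<subseteq> join U W"
    proof (rule vec.span_minimal)
      show "{a, b} \<subseteq> join U W"
        using z join_upper1[OF sub(2), of U] join_upper2[OF sub(1), of W] by blast
    qed (simp add: sub subspace_join)
    moreover have "on_quadric Q (vec.span {a, b})"
      using z U W by (intro on_quadric_span_pair) (auto simp: on_quadric_Q)
    ultimately have "?S \<inter> {v. v \<in> vec.span {a, b}} = vec.span {a, b} - {0}"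
      by (auto simp: on_quadric_Q)
    then show ?thesis using z by (simp add: mult.commute sum_of_bool_mult_eq Int_def)
  qed
  have "(\<Sum>z\<in>perp_pairs U W. \<Sum>v\<in>vec.span {fst z, snd z} - {0}. g v)
      = (\<Sum>z\<in>perp_pairs U W. \<Sum>v\<in>?S. g v * of_bool (v \<in> vec.span {fst z, snd z}))"
    by (rule sum.cong[OF refl inner])
  also have "\<dots> = (\<Sum>v\<in>?S. \<Sum>z\<in>perp_pairs U W. g v * of_bool (v \<in> vec.span {fst z, snd z}))"
    by (rule sum.swap)
  also have "\<dots> = (\<Sum>v\<in>?S. g v * ?N v)"
    by (simp add: sum_of_bool_eq Int_def flip: sum_distrib_left)
  also have "\<dots> = (\<Sum>v\<in>?S - ?UW. g v * ?N v) + (\<Sum>v\<in>?UW. g v * ?N v)"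
    using sub_S by (intro sum.subset_diff) simp_all
  also have "(\<Sum>v\<in>?UW. g v * ?N v)
      = (\<Sum>v\<in>U - {0}. g v * ?N v) + (\<Sum>v\<in>W - {0}. g v * ?N v)"
    by (rule sum.union_disjoint) (use UW in auto)
  also have "(\<Sum>v\<in>?S - ?UW. g v * ?N v) = (\<Sum>v\<in>?S - ?UW. (q - 1)\<^sup>2 * g v)"
    by (intro sum.cong refl, subst card_perp_pairs_span_both[OF U W UW]) auto
  also have "\<dots> = (q - 1)\<^sup>2 * sum g (?S - ?UW)"
    by (rule sum_distrib_left[symmetric])
  also have "(\<Sum>v\<in>U - {0}. g v * ?N v) = (q - 1) * d * sum g (U - {0})"
    unfolding sum_distrib_left
    using card_perp_pairs_span_left[OF U W UW _ dU] by (intro sum.cong refl) simp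
  also have "(\<Sum>v\<in>W - {0}. g v * ?N v) = (q - 1) * d * sum g (W - {0})"
    unfolding sum_distrib_left
    using card_perp_pairs_span_right[OF U W UW _ dW] by (intro sum.cong refl) simp
  also have "sum g (?S - ?UW) = sum g ?S - (sum g (U - {0}) + sum g (W - {0}))"
  proof -
    have "sum g ?UW = sum g (U - {0}) + sum g (W - {0})"
      by (rule sum.union_disjoint) (use UW in auto)
    then show ?thesis using sum_diff[OF _ sub_S, of g] by simp
  qed
  finally show ?thesis by (simp add: algebra_simps)
qed

lemma card_perp_pairs:
  assumes "\<And>a. a \<in> U - {0} \<Longrightarrow> real (card {b\<in>W - {0}. B a b = 0}) = d"
  shows "real (card (perp_pairs U W)) = d * card (U - {0})"
proof -
  have "perp_pairs U W = (SIGMA a:U - {0}. {b\<in>W - {0}. B a b = 0})"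
    by (auto simp: perp_pairs_def)
  then show ?thesis using assms by (simp add: card_SigmaI mult.commute)
qed

end

section \<open>Members of a class through a singular line\<close>

context generator_class begin

lemma gens_through:
  assumes U: "on_quadric Q U" "vec.dim U \<le> 3"
  obtains \<pi> \<sigma> where "\<pi> \<in> P" "\<sigma> \<in> gens - P" "U \<subseteq> \<pi>" "U \<subseteq> \<sigma>"
proof -
  obtain \<pi>\<^sub>0 where \<pi>\<^sub>0: "\<pi>\<^sub>0 \<in> P" by (rule P_nonempty)
  let ?\<rho> = "join U (\<pi>\<^sub>0 \<inter> perp U)"
  have \<rho>: "?\<rho> \<in> gens" using gen_through[OF U(1)] \<pi>\<^sub>0 P_gens by blast
  have "U \<subseteq> ?\<rho>"
    using P_gens[OF \<pi>\<^sub>0] by (intro join_upper1) (simp add: gens_subspace vec.subspace_inter)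
  then obtain E where E: "vec.subspace E" "U \<subseteq> E" "E \<subseteq> ?\<rho>" "vec.dim E = 3"
    using subspace_between[of U ?\<rho> 3] \<rho> U by (auto simp: gens_subspace gens_dim on_quadric_subspace)
  then have "on_quadric Q E" using \<rho> gens_on_quadric on_quadric_subset by blast
  then obtain \<pi> \<sigma> where "\<pi> \<in> P" "\<sigma> \<in> gens - P" "E \<subseteq> \<pi>" "E \<subseteq> \<sigma>"
    using E(4) by (rule gens_through_plane)
  then show ?thesis using that[of \<pi> \<sigma>] E(2) by auto
qed

text \<open>Take a generator \<sigma> of the other class through \<open>l\<close>. Each member of
  \<open>P\<close> through \<open>l\<close> meets \<sigma> in a plane, and each vector of \<sigma>
  outside \<open>l\<close> lies in exactly one of these planes, which leaves (q^4 - q^2) / (q^3 -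
  q^2) members.\<close>

lemma card_pencil_line:
  assumes l: "sing_line l" shows "real (card (point_pencil P l)) = q + 1"
proof -
  note sub = sing_lineD[OF l]
  have "vec.dim l \<le> 3" using sub by simp
  with sub(1) obtain \<pi> \<sigma> where "\<pi> \<in> P" and \<sigma>: "\<sigma> \<in> gens - P" "l \<subseteq> \<sigma>"
    by (rule gens_through)
  let ?T = "point_pencil P l"
  have "(\<Sum>\<pi>\<in>?T. real (card {v\<in>\<sigma> - l. v \<in> \<pi>})) = (\<Sum>v\<in>\<sigma> - l. real (card {\<pi>\<in>?T. v \<in> \<pi>}))"
    by (intro sum_card_swap) simp_all
  moreover have "real (card {v\<in>\<sigma> - l. v \<in> \<pi>}) = q^3 - q^2" if "\<pi> \<in> ?T" for \<pi>
  proof -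
    have \<pi>: "\<pi> \<in> P" "l \<subseteq> \<pi>" using that by (auto simp: point_pencil_def)
    have "vec.dim (\<pi> \<inter> \<sigma>) \<ge> 2" using vec.dim_subset[of l "\<pi> \<inter> \<sigma>"] \<pi> \<sigma> sub by simp
    then have "vec.dim (\<pi> \<inter> \<sigma>) = 3" using P_opposite_dim \<pi> \<sigma> by blast
    moreover have "{v\<in>\<sigma> - l. v \<in> \<pi>} = \<pi> \<inter> \<sigma> - l" by blast
    moreover have "vec.subspace (\<pi> \<inter> \<sigma>)" using \<pi> \<sigma> P_gens gens_Int_subspace by blast
    ultimately show ?thesis using card_diff[of "\<pi> \<inter> \<sigma>" l] sub \<pi> \<sigma> by simp
  qed
  moreover have "real (card {\<pi>\<in>?T. v \<in> \<pi>}) = 1" if v: "v \<in> \<sigma> - l" for v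
  proof -
    have "vec.span (insert v l) \<subseteq> \<sigma>"
      using v \<sigma> by (simp add: span_insert_subset_iff gens_subspace)
    then have "on_quadric Q (vec.span (insert v l))"
      using \<sigma> gens_on_quadric on_quadric_subset vec.subspace_span by blast
    moreover have "vec.dim (vec.span (insert v l)) = 3" using dim_span_insert[of l v] v sub by simp
    ultimately obtain \<pi> where "\<And>\<tau>. \<tau> \<in> P \<and> vec.span (insert v l) \<subseteq> \<tau> \<longleftrightarrow> \<tau> = \<pi>"
      using ex1_P_through_plane by metis
    moreover have "\<tau> \<in> ?T \<and> v \<in> \<tau> \<longleftrightarrow> \<tau> \<in> P \<and> vec.span (insert v l) \<subseteq> \<tau>" for \<tau>
      by (cases "\<tau> \<in> P")
        (simp_all add: point_pencil_def span_insert_subset_iff gens_subspace P_gens conj_commute)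
    ultimately have "{\<pi>\<in>?T. v \<in> \<pi>} = {\<pi>}" by auto
    then show ?thesis by simp
  qed
  ultimately have "real (card ?T) * (q^3 - q^2) = real (card (\<sigma> - l))" by simp
  also have "\<dots> = q^4 - q^2"
    using card_diff[of \<sigma> l] \<sigma> sub by (simp add: gens_subspace gens_dim)
  finally have "(q^3 - q^2) * (real (card ?T) - (q + 1)) = 0"
    by (simp add: algebra_simps power2_eq_square power3_eq_cube power4_eq_xxxx)
  moreover have "q^3 - q^2 = q^2 * (q - 1)" by (simp add: algebra_simps power2_eq_square power3_eq_cube)
  ultimately show ?thesis using q_ge_2 by auto
qed

text \<open>Only the line \<tau> \<inter> perp l of \<tau> is perpendicular to \<open>l\<close>. A
  member of \<open>P\<close> through \<open>l\<close> that meets \<tau> meets it in a line, hence in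
  this one, so it is the join of the two lines.\<close>

lemma ex1_pencil_line_meeting:
  assumes l: "sing_line l" and \<tau>: "\<tau> \<in> P" and disj: "l \<inter> \<tau> = {0}"
  shows "\<exists>!\<pi>. \<pi> \<in> point_pencil P l \<and> \<pi> \<inter> \<tau> \<noteq> {0}"
proof -
  note sub = sing_lineD[OF l]
  let ?m = "\<tau> \<inter> perp l"
  let ?\<pi> = "join l ?m"
  have m: "vec.subspace ?m" using P_gens[OF \<tau>] by (simp add: gens_subspace vec.subspace_inter)
  have dim_m: "vec.dim ?m = 2"
    using dim_gen_meet_perp[OF P_gens[OF \<tau>] sub(3)] sub(2) disj by (simp add: Int_commute)
  have \<pi>: "?\<pi> \<in> gens" using gen_through[OF sub(1)] \<tau> P_gens by blast
  have l\<pi>: "l \<subseteq> ?\<pi>" and m\<pi>: "?m \<subseteq> ?\<pi>"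
    by (rule join_upper1[OF m], rule join_upper2[OF sub(3)])
  have in_perp: "\<rho> \<inter> \<tau> \<subseteq> ?m" if "\<rho> \<in> gens" "l \<subseteq> \<rho>" for \<rho>
    using gens_perp[OF that(1)] perp_antimono[OF that(2)] by blast
  have "?\<pi> \<inter> \<tau> = ?m" using in_perp[OF \<pi> l\<pi>] m\<pi> by blast
  then have "vec.dim (\<tau> \<inter> ?\<pi>) = 2" using dim_m by (simp add: Int_commute)
  then have \<pi>P: "?\<pi> \<in> P" using P_memI[OF \<tau> \<pi>] by simp
  show ?thesis
  proof (rule ex1I)
    have "?\<pi> \<inter> \<tau> \<noteq> {0}" using \<open>?\<pi> \<inter> \<tau> = ?m\<close> dim_m by auto
    then show "?\<pi> \<in> point_pencil P l \<and> ?\<pi> \<inter> \<tau> \<noteq> {0}"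
      using \<pi>P l\<pi> by (simp add: point_pencil_def)
    fix \<rho> assume "\<rho> \<in> point_pencil P l \<and> \<rho> \<inter> \<tau> \<noteq> {0}"
    then have \<rho>: "\<rho> \<in> P" "l \<subseteq> \<rho>" "\<rho> \<inter> \<tau> \<noteq> {0}" by (auto simp: point_pencil_def)
    have "\<rho> \<noteq> \<tau>"
    proof
      assume "\<rho> = \<tau>"
      then have "l = {0}" using disj \<rho> by auto
      then show False using sub by simp
    qed
    then have "vec.dim (\<rho> \<inter> \<tau>) = 2" using P_dim_cases \<rho> \<tau> by blast
    then have "\<rho> \<inter> \<tau> = ?m"
      using in_perp[of \<rho>] \<rho> P_gens \<tau> m dim_m gens_Int_subspace
      by (intro eq_of_dim_le) auto
    then have "?\<pi> \<subseteq> \<rho>" using \<rho> P_gens gens_subspace by (intro join_least) blast+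
    then show "\<rho> = ?\<pi>"
      using eq_of_dim_le[of ?\<pi> \<rho>] \<pi> P_gens[OF \<rho>(1)] by (simp add: gens_subspace gens_dim)
  qed
qed

end

section \<open>First counts in a Cameron-Liebler set\<close>

locale cameron_liebler = generator_class +
  fixes L and x :: real
  assumes CL: "cameron_liebler_set P L x"
begin

lemma L_subset: "L \<subseteq> P"
  using CL by (simp add: cameron_liebler_set_def)

lemma L_gens: "\<tau> \<in> L \<Longrightarrow> \<tau> \<in> gens"
  using L_subset P_gens by blast

lemma card_L: "real (card L) = x * ((q + 1) * (q\<^sup>2 + 1))"
proof -
  have "(q + 1) * (q\<^sup>2 + 1) \<noteq> 0" using q_ge_2 by (auto simp: add_nonneg_eq_0_iff)
  moreover have "x = real (card L) / ((q + 1) * (q\<^sup>2 + 1))"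
    using CL by (simp add: cameron_liebler_set_def flip: q_eq)
  ultimately show ?thesis by (metis nonzero_eq_divide_eq)
qed

lemma card_disjoint:
  "\<pi> \<in> P \<Longrightarrow> real (card {\<tau>\<in>L. \<pi> \<inter> \<tau> = {0}}) = (x - of_bool (\<pi> \<in> L)) * q^3"
  using CL by (simp add: cameron_liebler_set_def proj_disjoint_def flip: q_eq)

definition meeting :: "('a^8) set \<Rightarrow> ('a^8) set set" where
  "meeting U = {\<tau>\<in>L. U \<inter> \<tau> \<noteq> {0}}"

lemma card_meeting:
  assumes "\<pi> \<in> P"
  shows "real (card (meeting \<pi>)) = x * (q\<^sup>2 + q + 1) + q^3 * of_bool (\<pi> \<in> L)"
proof -
  have "meeting \<pi> = L - {\<tau>\<in>L. \<pi> \<inter> \<tau> = {0}}" by (auto simp: meeting_def)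
  then have "real (card (meeting \<pi>)) = real (card L) - real (card {\<tau>\<in>L. \<pi> \<inter> \<tau> = {0}})"
    by (simp add: card_Diff_subset of_nat_diff card_mono)
  then show ?thesis
    using card_disjoint[OF assms] by (simp add: card_L algebra_simps power2_eq_square power3_eq_cube)
qed

definition t :: "('a^8) set \<Rightarrow> real" where
  "t l = real (card {\<tau>\<in>L. l \<subseteq> \<tau>})"

text \<open>Count pairs of a member of \<open>P\<close> through \<open>l\<close> and a member of
  \<open>L\<close> meeting it. A \<tau> that meets \<open>l\<close> meets all q + 1 of the former,
  any other \<tau> exactly one.\<close>

lemma card_meeting_line:
  assumes l: "sing_line l"
  shows "real (card (meeting l)) = q\<^sup>2 * t l + x * (q + 1)"
proof -
  let ?T = "point_pencil P l"
  have TP: "\<pi> \<in> P" if "\<pi> \<in> ?T" for \<pi> using that by (simp add: point_pencil_def)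
  have TL: "{\<pi>\<in>?T. \<pi> \<in> L} = {\<tau>\<in>L. l \<subseteq> \<tau>}" using L_subset by (auto simp: point_pencil_def)
  have "(\<Sum>\<pi>\<in>?T. real (card {\<tau>\<in>L. \<pi> \<inter> \<tau> \<noteq> {0}})) = (\<Sum>\<tau>\<in>L. real (card {\<pi>\<in>?T. \<pi> \<inter> \<tau> \<noteq> {0}}))"
    by (intro sum_card_swap) simp_all
  also have "(\<Sum>\<tau>\<in>L. real (card {\<pi>\<in>?T. \<pi> \<inter> \<tau> \<noteq> {0}})) = (\<Sum>\<tau>\<in>L. 1 + q * of_bool (l \<inter> \<tau> \<noteq> {0}))"
  proof (rule sum.cong[OF refl])
    fix \<tau> assume \<tau>: "\<tau> \<in> L"
    show "real (card {\<pi>\<in>?T. \<pi> \<inter> \<tau> \<noteq> {0}}) = 1 + q * of_bool (l \<inter> \<tau> \<noteq> {0})"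
    proof (cases "l \<inter> \<tau> = {0}")
      case True
      then obtain \<pi> where "\<And>\<rho>. \<rho> \<in> ?T \<and> \<rho> \<inter> \<tau> \<noteq> {0} \<longleftrightarrow> \<rho> = \<pi>"
        using ex1_pencil_line_meeting[OF l _ True] \<tau> L_subset by (metis subsetD)
      then have "{\<pi>\<in>?T. \<pi> \<inter> \<tau> \<noteq> {0}} = {\<pi>}" by auto
      then show ?thesis using True by simp
    next
      case False
      moreover have "0 \<in> l \<inter> \<tau>"
        using sing_lineD(3)[OF l] L_gens[OF \<tau>] by (simp add: gens_subspace vec.subspace_0)
      ultimately obtain v where "v \<in> l \<inter> \<tau>" "v \<noteq> 0" by blast
      then have "{\<pi>\<in>?T. \<pi> \<inter> \<tau> \<noteq> {0}} = ?T" by (auto simp: point_pencil_def)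
      then show ?thesis using False card_pencil_line[OF l] by simp
    qed
  qed
  also have "\<dots> = card L + q * card (meeting l)"
    by (subst sum_of_bool) (simp_all add: meeting_def)
  also have "(\<Sum>\<pi>\<in>?T. real (card {\<tau>\<in>L. \<pi> \<inter> \<tau> \<noteq> {0}}))
      = (\<Sum>\<pi>\<in>?T. x * (q\<^sup>2 + q + 1) + q^3 * of_bool (\<pi> \<in> L))"
    using TP card_meeting by (intro sum.cong refl) (simp add: meeting_def)
  also have "\<dots> = x * (q\<^sup>2 + q + 1) * (q + 1) + q^3 * t l"
    by (subst sum_of_bool) (simp_all add: card_pencil_line[OF l] TL t_def)
  finally have "q * (real (card (meeting l)) - (q\<^sup>2 * t l + x * (q + 1))) = 0"
    by (simp add: card_L algebra_simps power2_eq_square power3_eq_cube)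
  then show ?thesis using q_ge_2 by simp
qed

text \<open>The weight of the point spanned by \<open>v\<close>. Summing weights over subspaces
  turns incidences with \<open>L\<close> into linear equations.\<close>

definition g :: "'a^8 \<Rightarrow> real" where
  "g v = real (card {\<tau>\<in>L. v \<in> \<tau>})"

lemma sum_g: "sum g (U - {0}) = (\<Sum>\<tau>\<in>L. real (card (U \<inter> \<tau> - {0})))"
proof -
  have "sum g (U - {0}) = (\<Sum>\<tau>\<in>L. real (card {v\<in>U - {0}. v \<in> \<tau>}))"
    unfolding g_def by (intro sum_card_swap) simp_all
  moreover have "{v\<in>U - {0}. v \<in> \<tau>} = U \<inter> \<tau> - {0}" for \<tau> by blast
  ultimately show ?thesis by simp
qed

lemma line_Int_cases:
  assumes l: "vec.subspace l" "vec.dim l = 2" and \<tau>: "vec.subspace \<tau>"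
  obtains "l \<inter> \<tau> = {0}" "\<not> l \<subseteq> \<tau>" | "l \<inter> \<tau> \<noteq> {0}" "\<not> l \<subseteq> \<tau>" "vec.dim (l \<inter> \<tau>) = 1" | "l \<subseteq> \<tau>" "l \<inter> \<tau> = l" "l \<noteq> {0}"
proof -
  have sub: "vec.subspace (l \<inter> \<tau>)" using l \<tau> by (simp add: vec.subspace_inter)
  have nz: "l \<noteq> {0}" using l by auto
  consider "l \<inter> \<tau> = {0}" | "l \<subseteq> \<tau>" | "l \<inter> \<tau> \<noteq> {0}" "\<not> l \<subseteq> \<tau>" by blast
  then show ?thesis
  proof cases
    case 1
    then have "\<not> l \<subseteq> \<tau>" using nz by blast
    then show ?thesis using 1 that by blast
  next
    case 2
    then show ?thesis using that nz by blast
  next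
    case 3
    have "vec.dim (l \<inter> \<tau>) \<noteq> 0" using dim_zero_iff[OF sub] 3 by blast
    moreover have "\<not> vec.dim l \<le> vec.dim (l \<inter> \<tau>)"
      using eq_of_dim_le[OF sub l(1)] 3 by blast
    ultimately have "vec.dim (l \<inter> \<tau>) = 1" using l(2) by linarith
    then show ?thesis using 3 that by blast
  qed
qed

text \<open>A \<tau> meeting \<open>l\<close> contributes q - 1 vectors, and q^2 - q more if it
  contains \<open>l\<close>. The total weight of a line is therefore affine in
  \<open>t l\<close>.\<close>

lemma sum_g_line:
  assumes l: "sing_line l"
  shows "sum g (l - {0}) = (q - 1) * ((q\<^sup>2 + q) * t l + x * (q + 1))"
proof -
  note sub = sing_lineD[OF l]
  have "sum g (l - {0}) = (\<Sum>\<tau>\<in>L. ((q - 1) * of_bool (l \<inter> \<tau> \<noteq> {0}) + (q\<^sup>2 - q) * of_bool (l \<subseteq> \<tau>)))"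
    unfolding sum_g
  proof (rule sum.cong[OF refl])
    fix \<tau> assume \<tau>: "\<tau> \<in> L"
    have \<tau>s: "vec.subspace \<tau>" using L_gens[OF \<tau>] gens_subspace by blast
    then have s: "vec.subspace (l \<inter> \<tau>)" using sub by (simp add: vec.subspace_inter)
    from sub(3,2) \<tau>s
    show "real (card (l \<inter> \<tau> - {0})) = (q - 1) * of_bool (l \<inter> \<tau> \<noteq> {0}) + (q\<^sup>2 - q) * of_bool (l \<subseteq> \<tau>)"
      by (rule line_Int_cases) (use card_nonzero[OF s] sub in auto)
  qed
  also have "\<dots> = (q - 1) * card (meeting l) + (q\<^sup>2 - q) * t l"
    by (subst sum_of_bool2) (simp_all add: meeting_def t_def)
  finally show ?thesis
    by (simp add: card_meeting_line[OF l] algebra_simps power2_eq_square power3_eq_cube)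
qed

text \<open>Every \<tau> meeting \<pi> contributes the q^2 - 1 nonzero vectors of a line, and \<pi>
  itself, if it is in \<open>L\<close>, q^4 - q^2 more.\<close>

lemma sum_g_P:
  assumes \<pi>: "\<pi> \<in> P"
  shows "sum g (\<pi> - {0}) = (q\<^sup>2 - 1) * (x * (q\<^sup>2 + q + 1) + q^3 * of_bool (\<pi> \<in> L))
    + (q^4 - q\<^sup>2) * of_bool (\<pi> \<in> L)"
proof -
  have "sum g (\<pi> - {0}) = (\<Sum>\<tau>\<in>L. ((q\<^sup>2 - 1) * of_bool (\<pi> \<inter> \<tau> \<noteq> {0}) + (q^4 - q\<^sup>2) * of_bool (\<tau> = \<pi>)))"
    unfolding sum_g
  proof (rule sum.cong[OF refl])
    fix \<tau> assume \<tau>: "\<tau> \<in> L"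
    then have \<tau>P: "\<tau> \<in> P" using L_subset by blast
    then have s: "vec.subspace (\<pi> \<inter> \<tau>)" using \<pi> P_gens gens_Int_subspace by blast
    consider "\<tau> = \<pi>" | "\<tau> \<noteq> \<pi>" "\<pi> \<inter> \<tau> = {0}" | "\<tau> \<noteq> \<pi>" "\<pi> \<inter> \<tau> \<noteq> {0}" by blast
    then show "real (card (\<pi> \<inter> \<tau> - {0})) = (q\<^sup>2 - 1) * of_bool (\<pi> \<inter> \<tau> \<noteq> {0}) + (q^4 - q\<^sup>2) * of_bool (\<tau> = \<pi>)"
    proof cases
      case 1
      moreover have "\<pi> \<noteq> {0}" using gens_dim[OF P_gens[OF \<pi>]] by auto
      ultimately show ?thesis
        using card_nonzero[of \<pi>] P_gens[OF \<pi>] by (simp add: gens_subspace gens_dim)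
    next
      case 3
      then have "vec.dim (\<pi> \<inter> \<tau>) = 2" using P_dim_cases \<pi> \<tau>P by blast
      then show ?thesis using card_nonzero[OF s] 3 by simp
    qed simp
  qed
  also have "\<dots> = (q\<^sup>2 - 1) * card (meeting \<pi>) + (q^4 - q\<^sup>2) * card {\<tau>\<in>L. \<tau> = \<pi>}"
    by (subst sum_of_bool2) (simp_all add: meeting_def)
  also have "{\<tau>\<in>L. \<tau> = \<pi>} = (if \<pi> \<in> L then {\<pi>} else {})" by auto
  finally show ?thesis by (simp add: card_meeting[OF \<pi>])
qed

lemma sum_g_singular: "sum g ({v. Q v = 0} - {0}) = card L * (q^4 - 1)"
proof -
  have "real (card ({v. Q v = 0} \<inter> \<tau> - {0})) = q^4 - 1" if "\<tau> \<in> L" for \<tau>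
  proof -
    have "{v. Q v = 0} \<inter> \<tau> = \<tau>" using L_gens[OF that] by (auto simp: on_quadric_Q[OF gens_on_quadric])
    then show ?thesis
      using card_nonzero[of \<tau>] L_gens[OF that] by (simp add: gens_subspace gens_dim)
  qed
  then show ?thesis unfolding sum_g by simp
qed

text \<open>The weight \<open>g\<close>, summed over the spans of all perpendicular pairs, is
  evaluated twice. Line by line it is affine in \<open>t\<close>, and summing \<open>t\<close>
  counts the pairs inside each \<tau>; vector by vector it is given by
  \<open>sum_perp_pairs_span\<close>. The equation serves for two disjoint generators and for two
  disjoint lines of one generator.\<close>

lemma sum_perp_pairs_L:
  assumes U: "on_quadric Q U" and W: "on_quadric Q W" and UW: "U \<inter> W = {0}"
    and dU: "\<And>a. a \<in> U - {0} \<Longrightarrow> real (card {b\<in>W - {0}. B a b = 0}) = d"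
    and dW: "\<And>b. b \<in> W - {0} \<Longrightarrow> real (card {a\<in>U - {0}. B a b = 0}) = d"
  shows "(q - 1) * ((q\<^sup>2 + q) * (\<Sum>\<tau>\<in>L. real (card (U \<inter> \<tau> - {0})) * real (card (W \<inter> \<tau> - {0})))
      + x * (q + 1) * (d * card (U - {0}))) =
    (q - 1)\<^sup>2 * (sum g ({v\<in>join U W. Q v = 0} - {0}) - sum g (U - {0}) - sum g (W - {0}))
    + (q - 1) * d * (sum g (U - {0}) + sum g (W - {0}))"
proof -
  let ?Z = "perp_pairs U W"
  have line: "sing_line (vec.span {fst z, snd z})" if "z \<in> ?Z" for z
  proof -
    obtain a b where ab: "z = (a, b)" by (cases z)
    then have z: "z = (a, b)" "a \<in> U" "a \<noteq> 0" "b \<in> W" "b \<noteq> 0" "B a b = 0"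
      using that by (auto simp: perp_pairs_def)
    have "b \<notin> vec.span {a}"
    proof
      assume "b \<in> vec.span {a}"
      then have "b \<in> U" using z vec.span_minimal[of "{a}" U] on_quadric_subspace[OF U] by blast
      then show False using z UW by blast
    qed
    then show ?thesis
      using z U W by (auto simp: sing_line_def dim_pair on_quadric_Q intro!: on_quadric_span_pair simp del: vec.dim_span)
  qed
  have "(\<Sum>z\<in>?Z. \<Sum>v\<in>vec.span {fst z, snd z} - {0}. g v)
      = (\<Sum>z\<in>?Z. (q - 1) * (q\<^sup>2 + q) * t (vec.span {fst z, snd z}) + (q - 1) * x * (q + 1))"
    using sum_g_line[OF line] by (intro sum.cong refl) (simp add: algebra_simps)
  also have "\<dots> = (q - 1) * ((q\<^sup>2 + q) * (\<Sum>z\<in>?Z. t (vec.span {fst z, snd z})) + x * (q + 1) * card ?Z)"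
    unfolding sum.distrib sum_distrib_left[symmetric] by (simp add: algebra_simps)
  also have "(\<Sum>z\<in>?Z. t (vec.span {fst z, snd z})) = (\<Sum>z\<in>?Z. real (card {\<tau>\<in>L. fst z \<in> \<tau> \<and> snd z \<in> \<tau>}))"
  proof -
    have "{\<tau>\<in>L. vec.span {a, b} \<subseteq> \<tau>} = {\<tau>\<in>L. a \<in> \<tau> \<and> b \<in> \<tau>}" for a b
      by (rule Collect_cong) (use span_insert_subset_iff[OF gens_subspace[OF L_gens], of _ a "{b}"] in blast)
    then show ?thesis by (simp add: t_def)
  qed
  also have "\<dots> = (\<Sum>\<tau>\<in>L. real (card {z\<in>?Z. fst z \<in> \<tau> \<and> snd z \<in> \<tau>}))"
    by (intro sum_card_swap) simp_all
  also have "\<dots> = (\<Sum>\<tau>\<in>L. real (card (U \<inter> \<tau> - {0})) * real (card (W \<inter> \<tau> - {0})))"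
  proof (rule sum.cong[OF refl])
    fix \<tau> assume "\<tau> \<in> L"
    \<comment> \<open>Inside a totally singular \<tau> perpendicularity is automatic, so the pairs
      form a full product.\<close>
    then have "B a b = 0" if "a \<in> \<tau>" "b \<in> \<tau>" for a b
      using on_quadric_B[OF gens_on_quadric[OF L_gens]] that by blast
    then have "{z\<in>?Z. fst z \<in> \<tau> \<and> snd z \<in> \<tau>} = (U \<inter> \<tau> - {0}) \<times> (W \<inter> \<tau> - {0})"
      unfolding perp_pairs_def by auto
    then show "real (card {z\<in>?Z. fst z \<in> \<tau> \<and> snd z \<in> \<tau>})
        = real (card (U \<inter> \<tau> - {0})) * real (card (W \<inter> \<tau> - {0}))"
      by (simp add: card_cartesian_product)
  qed
  finally show ?thesis
    using sum_perp_pairs_span[OF U W UW dU dW, of g] card_perp_pairs[of U W d, OF dU] by simp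
qed

end

context hyperbolic_space begin

lemma card_nonzero_perp_gen:
  assumes \<pi>: "\<pi> \<in> gens" and a: "a \<notin> \<pi>"
  shows "real (card {b\<in>\<pi> - {0}. B a b = 0}) = q^3 - 1"
proof -
  have "a \<notin> perp \<pi>" using \<pi> a by (simp add: gens_perp)
  then obtain w where "w \<in> \<pi>" "B a w \<noteq> 0" by (auto simp: perp_def B_commute)
  then have "vec.dim (\<pi> \<inter> perp {a}) = 3"
    using dim_meet_perp_singleton[OF gens_subspace[OF \<pi>], of w a] \<pi> by (simp add: gens_dim)
  moreover have "{b\<in>\<pi> - {0}. B a b = 0} = \<pi> \<inter> perp {a} - {0}" by (auto simp: perp_def)
  moreover have "vec.subspace (\<pi> \<inter> perp {a})" using \<pi> by (simp add: gens_subspace vec.subspace_inter)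
  ultimately show ?thesis by (simp add: card_nonzero)
qed

end

section \<open>Members of the set meeting two disjoint subspaces, and full lines\<close>

context cameron_liebler begin

text \<open>A \<tau> meeting both generators differs from both and meets each in a line, so it
  contributes (q^2 - 1)^2 to the product sum in \<open>sum_perp_pairs_L\<close>. The two generators
  span the whole space, so every other term there is known and the equation can be solved for the
  count.\<close>

lemma card_common_meeting:
  assumes \<pi>: "\<pi> \<in> P" and \<pi>': "\<pi>' \<in> P" and disj: "\<pi> \<inter> \<pi>' = {0}"
  shows "real (card {\<tau>\<in>L. \<pi> \<inter> \<tau> \<noteq> {0} \<and> \<pi>' \<inter> \<tau> \<noteq> {0}})
    = q\<^sup>2 * (of_bool (\<pi> \<in> L) + of_bool (\<pi>' \<in> L)) + x * (q + 1)"
proof -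
  note g\<pi> = P_gens[OF \<pi>] P_gens[OF \<pi>']
  let ?Y = "real (card {\<tau>\<in>L. \<pi> \<inter> \<tau> \<noteq> {0} \<and> \<pi>' \<inter> \<tau> \<noteq> {0}})"
  have "(\<Sum>\<tau>\<in>L. real (card (\<pi> \<inter> \<tau> - {0})) * real (card (\<pi>' \<inter> \<tau> - {0})))
      = (\<Sum>\<tau>\<in>L. 0 + (q\<^sup>2 - 1)\<^sup>2 * of_bool (\<pi> \<inter> \<tau> \<noteq> {0} \<and> \<pi>' \<inter> \<tau> \<noteq> {0}))"
  proof (rule sum.cong[OF refl])
    fix \<tau> assume "\<tau> \<in> L"
    then have \<tau>: "\<tau> \<in> P" using L_subset by blast
    show "real (card (\<pi> \<inter> \<tau> - {0})) * real (card (\<pi>' \<inter> \<tau> - {0}))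
        = 0 + (q\<^sup>2 - 1)\<^sup>2 * of_bool (\<pi> \<inter> \<tau> \<noteq> {0} \<and> \<pi>' \<inter> \<tau> \<noteq> {0})"
    proof (cases "\<pi> \<inter> \<tau> \<noteq> {0} \<and> \<pi>' \<inter> \<tau> \<noteq> {0}")
      case True
      then have ne: "\<pi> \<noteq> \<tau>" "\<pi>' \<noteq> \<tau>" using disj by (auto simp: Int_commute)
      have "vec.dim (\<pi> \<inter> \<tau>) = 2" "vec.dim (\<pi>' \<inter> \<tau>) = 2"
        using True ne P_dim_cases \<pi> \<pi>' \<tau> by blast+
      moreover have "vec.subspace (\<pi> \<inter> \<tau>)" "vec.subspace (\<pi>' \<inter> \<tau>)"
        using gens_Int_subspace g\<pi> P_gens[OF \<tau>] by blast+
      ultimately show ?thesis using True by (simp add: card_nonzero power2_eq_square)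
    qed auto
  qed
  then have Y: "(\<Sum>\<tau>\<in>L. real (card (\<pi> \<inter> \<tau> - {0})) * real (card (\<pi>' \<inter> \<tau> - {0}))) = (q\<^sup>2 - 1)\<^sup>2 * ?Y"
    by (subst (asm) sum_of_bool) simp_all
  have join: "join \<pi> \<pi>' = UNIV"
    using eq_of_dim_le[of "join \<pi> \<pi>'" UNIV] dim_join[of \<pi> \<pi>'] disj g\<pi> dim_UNIV_8
    by (simp add: gens_subspace gens_dim subspace_join)
  have d: "real (card {b\<in>\<pi>' - {0}. B a b = 0}) = q^3 - 1" if "a \<in> \<pi> - {0}" for a
    using card_nonzero_perp_gen[OF g\<pi>(2), of a] that disj by blast
  have d': "real (card {a\<in>\<pi> - {0}. B a b = 0}) = q^3 - 1" if "b \<in> \<pi>' - {0}" for b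
    using card_nonzero_perp_gen[OF g\<pi>(1), of b] that disj by (subst B_commute) blast
  have card_\<pi>: "real (card (\<pi> - {0})) = q^4 - 1"
    using card_nonzero[of \<pi>] g\<pi> by (simp add: gens_subspace gens_dim)
  define c c' :: real where "c = of_bool (\<pi> \<in> L)" and "c' = of_bool (\<pi>' \<in> L)"
  define y where "y = ?Y"
  have "(q - 1) * ((q\<^sup>2 + q) * ((q\<^sup>2 - 1)\<^sup>2 * y) + x * (q + 1) * ((q^3 - 1) * (q^4 - 1))) =
      (q - 1)\<^sup>2 * (x * ((q + 1) * (q\<^sup>2 + 1)) * (q^4 - 1)
        - ((q\<^sup>2 - 1) * (x * (q\<^sup>2 + q + 1) + q^3 * c) + (q^4 - q\<^sup>2) * c)
        - ((q\<^sup>2 - 1) * (x * (q\<^sup>2 + q + 1) + q^3 * c') + (q^4 - q\<^sup>2) * c'))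
      + (q - 1) * (q^3 - 1) * (((q\<^sup>2 - 1) * (x * (q\<^sup>2 + q + 1) + q^3 * c) + (q^4 - q\<^sup>2) * c)
        + ((q\<^sup>2 - 1) * (x * (q\<^sup>2 + q + 1) + q^3 * c') + (q^4 - q\<^sup>2) * c'))"
    using sum_perp_pairs_L[OF gens_on_quadric[OF g\<pi>(1)] gens_on_quadric[OF g\<pi>(2)] disj d d']
    unfolding Y join card_\<pi> sum_g_P[OF \<pi>] sum_g_P[OF \<pi>'] c_def c'_def y_def
    using sum_g_singular by (simp add: card_L)
  \<comment> \<open>The identity is linear in \<open>y\<close>, with a nonzero coefficient since
    \<open>q\<close> is at least 2.\<close>
  then have "(q - 1) * (q\<^sup>2 + q) * (q\<^sup>2 - 1)\<^sup>2 * (y - (q\<^sup>2 * (c + c') + x * (q + 1))) = 0"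
    by algebra
  moreover have "q\<^sup>2 + q > 0" "q\<^sup>2 - 1 > 0" "q - 1 > 0"
    using q_ge_2 power_strict_mono[of 1 q 2] by (auto intro: add_pos_pos)
  ultimately show ?thesis unfolding y_def c_def c'_def by simp
qed

lemma t_full:
  assumes "sing_line l" "point_pencil P l \<subseteq> L" shows "t l = q + 1"
proof -
  have "{\<tau>\<in>L. l \<subseteq> \<tau>} = point_pencil P l"
    using assms(2) L_subset by (auto simp: point_pencil_def)
  then show ?thesis using card_pencil_line[OF assms(1)] by (simp add: t_def)
qed

lemma meeting_mono:
  assumes "l \<subseteq> \<rho>" "vec.subspace l" shows "meeting l \<subseteq> meeting \<rho>"
proof
  fix \<tau> assume \<tau>: "\<tau> \<in> meeting l"
  then have "0 \<in> l \<inter> \<tau>" "l \<inter> \<tau> \<noteq> {0}"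
    using assms(2) L_gens gens_subspace by (auto simp: meeting_def vec.subspace_0)
  then show "\<tau> \<in> meeting \<rho>" using \<tau> assms(1) by (auto simp: meeting_def)
qed

text \<open>Whatever meets \<open>l\<close> meets \<rho>. Since \<rho> is not in \<open>L\<close>,
  only x(q^2 + q + 1) members of \<open>L\<close> do so, against q^2 t(l) + x(q + 1) meeting
  \<open>l\<close>.\<close>

lemma t_le:
  assumes l: "sing_line l" and \<rho>: "\<rho> \<in> point_pencil P l" "\<rho> \<notin> L"
  shows "t l \<le> x"
proof -
  have \<rho>P: "\<rho> \<in> P" "l \<subseteq> \<rho>" using \<rho> by (auto simp: point_pencil_def)
  have "real (card (meeting l)) \<le> real (card (meeting \<rho>))"
    using meeting_mono[OF \<rho>P(2) sing_lineD(3)[OF l]] by (simp add: card_mono)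
  then have "q\<^sup>2 * t l \<le> q\<^sup>2 * x"
    using card_meeting[OF \<rho>P(1)] card_meeting_line[OF l] \<rho> by (simp add: algebra_simps)
  then show ?thesis using q_ge_2 by simp
qed

text \<open>Inside \<pi> everything is perpendicular and \<open>l\<close>, \<open>m\<close> span
  \<pi>, so \<open>sum_perp_pairs_L\<close> determines the number \<open>k\<close> of members
  meeting both lines. As the members meeting \<open>l\<close> or \<open>m\<close> all meet \<pi>,
  inclusion-exclusion bounds \<open>x\<close> from below.\<close>

lemma full_lines_meet:
  assumes \<pi>: "\<pi> \<in> L"
    and l: "vec.subspace l" "l \<subseteq> \<pi>" "vec.dim l = 2" "point_pencil P l \<subseteq> L"
    and m: "vec.subspace m" "m \<subseteq> \<pi>" "vec.dim m = 2" "point_pencil P m \<subseteq> L"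
    and disj: "l \<inter> m = {0}"
  shows "q + 1 \<le> x"
proof -
  have \<pi>P: "\<pi> \<in> P" using \<pi> L_subset by blast
  note g\<pi> = P_gens[OF \<pi>P]
  have line: "sing_line l" "sing_line m" using sing_lineI g\<pi> l m by blast+
  let ?K = "{\<tau>\<in>L. l \<inter> \<tau> \<noteq> {0} \<and> m \<inter> \<tau> \<noteq> {0}}"
  \<comment> \<open>A \<tau> other than \<pi> that meets both lines meets each in a point and
    contributes (q - 1)^2; \<pi> contributes (q^2 - 1)^2, which the second indicator corrects
    for.\<close>
  have "(\<Sum>\<tau>\<in>L. real (card (l \<inter> \<tau> - {0})) * real (card (m \<inter> \<tau> - {0})))
      = (\<Sum>\<tau>\<in>L. (q - 1)\<^sup>2 * of_bool (l \<inter> \<tau> \<noteq> {0} \<and> m \<inter> \<tau> \<noteq> {0})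
          + ((q\<^sup>2 - 1)\<^sup>2 - (q - 1)\<^sup>2) * of_bool (\<tau> = \<pi>))"
  proof (rule sum.cong[OF refl])
    fix \<tau> assume \<tau>: "\<tau> \<in> L"
    then have \<tau>P: "\<tau> \<in> P" using L_subset by blast
    have \<tau>s: "vec.subspace \<tau>" using L_gens[OF \<tau>] gens_subspace by blast
    have sub: "vec.subspace (l \<inter> \<tau>)" "vec.subspace (m \<inter> \<tau>)"
      using l m \<tau>s by (simp_all add: vec.subspace_inter)
    \<comment> \<open>If \<tau> contained \<open>k\<close>, then \<pi> \<inter> \<tau> would be
      equal to \<open>k\<close> and \<tau> would miss the disjoint line \<open>k'\<close>.\<close>
    have one: "vec.dim (k \<inter> \<tau>) = 1"
      if k: "vec.subspace k" "k \<subseteq> \<pi>" "vec.dim k = 2" "k \<inter> k' = {0}" "k' \<subseteq> \<pi>"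
        and ne: "\<tau> \<noteq> \<pi>" "k \<inter> \<tau> \<noteq> {0}" "k' \<inter> \<tau> \<noteq> {0}" "0 \<in> k'" for k k'
      using k(1,3) \<tau>s
    proof (rule line_Int_cases)
      assume "k \<subseteq> \<tau>"
      have "0 \<in> k \<inter> \<tau>" using k \<tau>s by (simp add: vec.subspace_0)
      then have "\<pi> \<inter> \<tau> \<noteq> {0}" using ne k by blast
      then have "vec.dim (\<pi> \<inter> \<tau>) = 2" using P_dim_cases[OF \<pi>P \<tau>P] ne by blast
      then have "k = \<pi> \<inter> \<tau>"
        using k \<open>k \<subseteq> \<tau>\<close> gens_Int_subspace[OF g\<pi> P_gens[OF \<tau>P]] by (intro eq_of_dim_le) auto
      then have "k' \<inter> \<tau> \<subseteq> k \<inter> k'" using k by blast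
      then have False using ne k \<tau>s by (auto simp: vec.subspace_0)
      then show ?thesis ..
    qed (use ne in auto)
    consider "\<tau> = \<pi>" | "\<tau> \<noteq> \<pi>" "l \<inter> \<tau> \<noteq> {0} \<and> m \<inter> \<tau> \<noteq> {0}"
      | "\<tau> \<noteq> \<pi>" "l \<inter> \<tau> = {0} \<or> m \<inter> \<tau> = {0}" by blast
    then show "real (card (l \<inter> \<tau> - {0})) * real (card (m \<inter> \<tau> - {0}))
      = (q - 1)\<^sup>2 * of_bool (l \<inter> \<tau> \<noteq> {0} \<and> m \<inter> \<tau> \<noteq> {0})
          + ((q\<^sup>2 - 1)\<^sup>2 - (q - 1)\<^sup>2) * of_bool (\<tau> = \<pi>)"
    proof cases
      case 1
      then have "l \<inter> \<tau> = l" "m \<inter> \<tau> = m" "l \<noteq> {0}" "m \<noteq> {0}" using l m by auto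
      then show ?thesis using 1 l m by (simp add: card_nonzero power2_eq_square)
    next
      case 2
      have "vec.dim (l \<inter> \<tau>) = 1" "vec.dim (m \<inter> \<tau>) = 1"
        using one[of l m] one[of m l] l m disj 2 by (simp_all add: Int_commute vec.subspace_0)
      then show ?thesis using 2 sub by (simp add: card_nonzero power2_eq_square)
    qed auto
  qed
  also have "\<dots> = (q - 1)\<^sup>2 * real (card ?K) + ((q\<^sup>2 - 1)\<^sup>2 - (q - 1)\<^sup>2) * real (card {\<tau>\<in>L. \<tau> = \<pi>})"
    by (rule sum_of_bool2) simp
  also have "{\<tau>\<in>L. \<tau> = \<pi>} = {\<pi>}" using \<pi> by auto
  finally have K: "(\<Sum>\<tau>\<in>L. real (card (l \<inter> \<tau> - {0})) * real (card (m \<inter> \<tau> - {0})))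
      = (q - 1)\<^sup>2 * real (card ?K) + ((q\<^sup>2 - 1)\<^sup>2 - (q - 1)\<^sup>2)" by simp
  have join: "join l m = \<pi>"
    using eq_of_dim_le[of "join l m" \<pi>] dim_join[of l m] disj l m join_least[of \<pi> l m] g\<pi>
    by (simp add: gens_subspace gens_dim subspace_join)
  have S: "{v\<in>join l m. Q v = 0} - {0} = \<pi> - {0}"
    unfolding join using on_quadric_Q[OF gens_on_quadric[OF g\<pi>]] by blast
  have B0: "B a b = 0" if "a \<in> \<pi>" "b \<in> \<pi>" for a b
    using on_quadric_B[OF gens_on_quadric[OF g\<pi>]] that by blast
  have "{b\<in>m - {0}. B a b = 0} = m - {0}" if "a \<in> l - {0}" for a
    using that B0 l(2) m(2) by blast
  then have d: "real (card {b\<in>m - {0}. B a b = 0}) = q\<^sup>2 - 1" if "a \<in> l - {0}" for a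
    using that m by (simp add: card_nonzero)
  have "{a\<in>l - {0}. B a b = 0} = l - {0}" if "b \<in> m - {0}" for b
    using that B0 l(2) m(2) by blast
  then have d': "real (card {a\<in>l - {0}. B a b = 0}) = q\<^sup>2 - 1" if "b \<in> m - {0}" for b
    using that l by (simp add: card_nonzero)
  have card_l: "real (card (l - {0})) = q\<^sup>2 - 1" using l by (simp add: card_nonzero)
  define k where "k = real (card ?K)"
  let ?Gl = "(q - 1) * ((q\<^sup>2 + q) * (q + 1) + x * (q + 1))"
  have "(q - 1) * ((q\<^sup>2 + q) * ((q - 1)\<^sup>2 * k + ((q\<^sup>2 - 1)\<^sup>2 - (q - 1)\<^sup>2))
        + x * (q + 1) * ((q\<^sup>2 - 1) * (q\<^sup>2 - 1))) =
      (q - 1)\<^sup>2 * ((q\<^sup>2 - 1) * (x * (q\<^sup>2 + q + 1) + q^3) + (q^4 - q\<^sup>2) - ?Gl - ?Gl)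
      + (q - 1) * (q\<^sup>2 - 1) * (?Gl + ?Gl)"
    using sum_perp_pairs_L[OF sing_lineD(1)[OF line(1)] sing_lineD(1)[OF line(2)] disj d d']
    unfolding K S card_l sum_g_P[OF \<pi>P] sum_g_line[OF line(1)] sum_g_line[OF line(2)]
      t_full[OF line(1) l(4)] t_full[OF line(2) m(4)] k_def
    using \<pi> by simp
  then have "(q - 1)^3 * (q\<^sup>2 + q) * (k - (x + 2 * q\<^sup>2 + q)) = 0"
    by algebra
  moreover have "q\<^sup>2 + q > 0" "q - 1 > 0"
    using q_ge_2 by (auto intro: add_pos_pos)
  ultimately have k: "k = x + 2 * q\<^sup>2 + q" by simp
  \<comment> \<open>Inclusion-exclusion; what remains is the common factor q(q - 1) of the two
    sides.\<close>
  have "meeting l \<inter> meeting m = ?K" by (auto simp: meeting_def)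
  then have "real (card (meeting l \<union> meeting m)) + k = real (card (meeting l)) + real (card (meeting m))"
    using card_Un_Int[of "meeting l" "meeting m"] by (simp add: k_def flip: of_nat_add)
  moreover have "real (card (meeting l \<union> meeting m)) \<le> real (card (meeting \<pi>))"
    using meeting_mono[OF l(2,1)] meeting_mono[OF m(2,1)] by (simp add: card_mono)
  moreover have "real (card (meeting \<pi>)) = x * (q\<^sup>2 + q + 1) + q^3"
    using card_meeting[OF \<pi>P] \<pi> by simp
  ultimately have "2 * (q\<^sup>2 * (q + 1) + x * (q + 1)) - (x + 2 * q\<^sup>2 + q) \<le> x * (q\<^sup>2 + q + 1) + q^3"
    unfolding card_meeting_line[OF line(1)] card_meeting_line[OF line(2)]
      t_full[OF line(1) l(4)] t_full[OF line(2) m(4)] k by (simp add: algebra_simps)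
  then have "q * (q - 1) * (q + 1) \<le> q * (q - 1) * x"
    by (simp add: algebra_simps power2_eq_square power3_eq_cube)
  moreover have "q * (q - 1) > 0" using q_ge_2 by simp
  ultimately show ?thesis by (simp only: mult_le_cancel_left_pos)
qed

text \<open>Count the pairs of meeting members \<tau>, s of \<open>L\<close>, where \<tau> meets
  \<pi> and \<open>s\<close> does not. This fixes the sum of x + q - t(\<pi> \<inter> \<tau>) over
  \<tau>. A term is x - 1 at a full line and at least \<open>q\<close> otherwise, so a small sum
  needs many full lines.\<close>

lemma card_full_neighbours:
  assumes \<pi>: "\<pi> \<in> L" and x: "x < q + 1"
  shows "(q + 1 - x) * real (card {\<tau>\<in>meeting \<pi> - {\<pi>}. point_pencil P (\<pi> \<inter> \<tau>) \<subseteq> L})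
    \<ge> q * (x * (q\<^sup>2 + q + 1) + q^3 - 1) - (x - 1) * q * (2 * q\<^sup>2 + x * (q + 1))"
proof -
  have \<pi>P: "\<pi> \<in> P" using \<pi> L_subset by blast
  let ?A = "meeting \<pi> - {\<pi>}"
  let ?S = "{s\<in>L. \<pi> \<inter> s = {0}}"
  let ?full = "\<lambda>\<tau>. point_pencil P (\<pi> \<inter> \<tau>) \<subseteq> L"
  have A: "\<tau> \<in> P" "\<tau> \<noteq> \<pi>" "sing_line (\<pi> \<inter> \<tau>)" if "\<tau> \<in> ?A" for \<tau>
  proof -
    show \<tau>: "\<tau> \<in> P" "\<tau> \<noteq> \<pi>" using that L_subset by (auto simp: meeting_def)
    have "vec.dim (\<pi> \<inter> \<tau>) = 2" using P_dim_cases[OF \<pi>P \<tau>(1)] that by (auto simp: meeting_def)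
    then show "sing_line (\<pi> \<inter> \<tau>)"
      using gens_Int_on_quadric P_gens \<pi>P \<tau> by (simp add: sing_line_def)
  qed
  have "\<pi> \<noteq> {0}" using gens_dim[OF P_gens[OF \<pi>P]] by auto
  then have "\<pi> \<in> meeting \<pi>" using \<pi> by (simp add: meeting_def)
  then have "card (meeting \<pi>) > 0" by (auto simp: card_gt_0_iff)
  then have card_A: "real (card ?A) = x * (q\<^sup>2 + q + 1) + q^3 - 1"
    using card_meeting[OF \<pi>P] \<pi> \<open>\<pi> \<in> meeting \<pi>\<close>
    by (simp add: card_Diff_singleton of_nat_diff Suc_leI)
  \<comment> \<open>For s in \<open>L\<close> that meets \<tau>, being disjoint from \<pi> is the
    same as being disjoint from the line \<pi> \<inter> \<tau>, so the count is a difference of two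
    known ones.\<close>
  have left: "real (card {s\<in>?S. \<tau> \<inter> s \<noteq> {0}}) = q\<^sup>2 * (x + q - t (\<pi> \<inter> \<tau>))" if \<tau>: "\<tau> \<in> ?A" for \<tau>
  proof -
    let ?l = "\<pi> \<inter> \<tau>"
    note l = A(3)[OF \<tau>]
    have "{s\<in>?S. \<tau> \<inter> s \<noteq> {0}} = meeting \<tau> - meeting ?l"
    proof (intro equalityI subsetI)
      fix s assume "s \<in> {s\<in>?S. \<tau> \<inter> s \<noteq> {0}}"
      then have s: "s \<in> L" "\<pi> \<inter> s = {0}" "\<tau> \<inter> s \<noteq> {0}" by auto
      have "0 \<in> ?l \<inter> s" 
        using vec.subspace_0[OF sing_lineD(3)[OF l]] vec.subspace_0[OF gens_subspace[OF L_gens[OF s(1)]]]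
        by simp
      then have "?l \<inter> s = {0}" using s(2) by blast
      then show "s \<in> meeting \<tau> - meeting ?l" using s by (simp add: meeting_def)
    next
      fix s assume "s \<in> meeting \<tau> - meeting ?l"
      then have s: "s \<in> L" "\<tau> \<inter> s \<noteq> {0}" "?l \<inter> s = {0}" by (auto simp: meeting_def)
      \<comment> \<open>Of the members of \<open>P\<close> through the line only one meets
        \<open>s\<close>. That one is \<tau>, so \<pi> does not.\<close>
      then have "\<exists>!\<rho>. \<rho> \<in> point_pencil P ?l \<and> \<rho> \<inter> s \<noteq> {0}"
        using L_subset by (intro ex1_pencil_line_meeting[OF l]) auto
      moreover have "\<tau> \<in> point_pencil P ?l" "\<pi> \<in> point_pencil P ?l"
        using A[OF \<tau>] \<pi>P by (auto simp: point_pencil_def)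
      ultimately have "\<pi> \<inter> s = {0}" using s A(2)[OF \<tau>] by blast
      then show "s \<in> {s\<in>?S. \<tau> \<inter> s \<noteq> {0}}" using s by simp
    qed
    moreover have "meeting ?l \<subseteq> meeting \<tau>"
      using sing_lineD(3)[OF l] by (intro meeting_mono) auto
    ultimately have "real (card {s\<in>?S. \<tau> \<inter> s \<noteq> {0}}) = real (card (meeting \<tau>)) - real (card (meeting ?l))"
      by (simp add: card_Diff_subset of_nat_diff card_mono)
    then show ?thesis
      using card_meeting[OF A(1)[OF \<tau>]] card_meeting_line[OF l] \<tau>
      by (simp add: meeting_def algebra_simps power2_eq_square power3_eq_cube)
  qed
  have right: "real (card {\<tau>\<in>?A. \<tau> \<inter> s \<noteq> {0}}) = 2 * q\<^sup>2 + x * (q + 1)" if s: "s \<in> ?S" for s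
  proof -
    have "{\<tau>\<in>?A. \<tau> \<inter> s \<noteq> {0}} = {\<tau>\<in>L. \<pi> \<inter> \<tau> \<noteq> {0} \<and> s \<inter> \<tau> \<noteq> {0}}"
      using s by (auto simp: meeting_def Int_commute)
    moreover have "s \<in> P" "\<pi> \<inter> s = {0}" "s \<in> L" using s L_subset by auto
    ultimately show ?thesis using card_common_meeting[OF \<pi>P, of s] \<pi> by simp
  qed
  have "(\<Sum>\<tau>\<in>?A. real (card {s\<in>?S. \<tau> \<inter> s \<noteq> {0}})) = (\<Sum>s\<in>?S. real (card {\<tau>\<in>?A. \<tau> \<inter> s \<noteq> {0}}))"
    by (intro sum_card_swap) simp_all
  then have "(\<Sum>\<tau>\<in>?A. q\<^sup>2 * (x + q - t (\<pi> \<inter> \<tau>))) = real (card ?S) * (2 * q\<^sup>2 + x * (q + 1))"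
    using left right by simp
  also have "\<dots> = q\<^sup>2 * ((x - 1) * q * (2 * q\<^sup>2 + x * (q + 1)))"
    using card_disjoint[OF \<pi>P] \<pi> by (simp add: power2_eq_square power3_eq_cube)
  finally have "(\<Sum>\<tau>\<in>?A. x + q - t (\<pi> \<inter> \<tau>)) = (x - 1) * q * (2 * q\<^sup>2 + x * (q + 1))"
    using q_ge_2 by (simp flip: sum_distrib_left)
  \<comment> \<open>The gap for \<open>t\<close> enters here: it is q + 1 on a full line and at most
    \<open>x\<close> on any other.\<close>
  moreover have "(\<Sum>\<tau>\<in>?A. q + (x - 1 - q) * of_bool (?full \<tau>)) \<le> (\<Sum>\<tau>\<in>?A. x + q - t (\<pi> \<inter> \<tau>))"
  proof (rule sum_mono)
    fix \<tau> assume \<tau>: "\<tau> \<in> ?A"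
    show "q + (x - 1 - q) * of_bool (?full \<tau>) \<le> x + q - t (\<pi> \<inter> \<tau>)"
    proof (cases "?full \<tau>")
      case True
      then show ?thesis using t_full[OF A(3)[OF \<tau>]] by simp
    next
      case False
      then obtain \<rho> where "\<rho> \<in> point_pencil P (\<pi> \<inter> \<tau>)" "\<rho> \<notin> L" by blast
      then show ?thesis using t_le[OF A(3)[OF \<tau>]] False by simp
    qed
  qed
  moreover have "(\<Sum>\<tau>\<in>?A. q + (x - 1 - q) * of_bool (?full \<tau>))
      = q * card ?A + (x - 1 - q) * card {\<tau>\<in>?A. ?full \<tau>}"
    by (rule sum_of_bool) simp
  ultimately show ?thesis using card_A by (simp add: algebra_simps)
qed

end

section \<open>Point-pencils and base-solids\<close>

context generator_class begin

lemma pointsD: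
  assumes "p \<in> points Q"
  obtains c where "c \<noteq> 0" "Q c = 0" "p = vec.span {c}"
proof -
  have p: "on_quadric Q p" "vec.dim p = 1" using assms by (auto simp: points_def proj_dim_def)
  note ps = on_quadric_subspace[OF p(1)]
  have "p \<noteq> {0}" using p by auto
  then obtain c where c: "c \<in> p" "c \<noteq> 0" using vec.subspace_0[OF ps] by blast
  have "vec.span {c} = p"
    using c ps p by (intro eq_of_dim_le vec.span_minimal) auto
  moreover have "Q c = 0" using p(1) c(1) by (rule on_quadric_Q)
  ultimately show ?thesis using c(2) by (intro that[of c]) simp_all
qed

lemma pointsI: "c \<noteq> 0 \<Longrightarrow> Q c = 0 \<Longrightarrow> vec.span {c} \<in> points Q"
  by (simp add: points_def proj_dim_def on_quadric_span_singleton)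

lemma pencil_iff: "\<tau> \<in> point_pencil P (vec.span {c}) \<longleftrightarrow> \<tau> \<in> P \<and> c \<in> \<tau>"
  using span_insert_subset_iff[OF gens_subspace[OF P_gens], of \<tau> c "{}"]
  by (auto simp: point_pencil_def)

lemma base_solid_iff: "\<tau> \<in> base_solid P \<sigma> \<longleftrightarrow> \<tau> \<in> P \<and> vec.dim (\<tau> \<inter> \<sigma>) = 3"
  by (auto simp: base_solid_def proj_dim_def)

lemma base_solidI:
  "\<tau> \<in> P \<Longrightarrow> \<sigma> \<in> gens - P \<Longrightarrow> U \<subseteq> \<tau> \<Longrightarrow> U \<subseteq> \<sigma> \<Longrightarrow> vec.dim U \<ge> 2 \<Longrightarrow> \<tau> \<in> base_solid P \<sigma>"
  using P_opposite_dim[of \<tau> \<sigma>] vec.dim_subset[of U "\<tau> \<inter> \<sigma>"] by (simp add: base_solid_iff)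

lemma pencil_members_meet:
  assumes "p \<in> points Q" "\<rho> \<in> point_pencil P p" "\<tau> \<in> point_pencil P p"
  shows "\<rho> \<inter> \<tau> \<noteq> {0}"
proof -
  obtain c where "c \<noteq> 0" "p = vec.span {c}" by (rule pointsD[OF assms(1)])
  then show ?thesis using assms by (auto simp: pencil_iff)
qed

text \<open>Both members contain planes of the same solid, and 3 + 3 > 4.\<close>

lemma base_solid_members_meet:
  assumes \<sigma>: "\<sigma> \<in> gens - P" and \<rho>: "\<rho> \<in> base_solid P \<sigma>" and \<tau>: "\<tau> \<in> base_solid P \<sigma>"
  shows "\<rho> \<inter> \<tau> \<noteq> {0}"
proof
  assume *: "\<rho> \<inter> \<tau> = {0}"
  have sub: "vec.subspace (\<rho> \<inter> \<sigma>)" "vec.subspace (\<tau> \<inter> \<sigma>)"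
    using gens_Int_subspace P_gens \<sigma> \<rho> \<tau> by (auto simp: base_solid_iff)
  have "join (\<rho> \<inter> \<sigma>) (\<tau> \<inter> \<sigma>) \<subseteq> \<sigma>" using \<sigma> by (intro join_least) (auto simp: gens_subspace)
  then have "vec.dim (join (\<rho> \<inter> \<sigma>) (\<tau> \<inter> \<sigma>)) \<le> 4"
    using vec.dim_subset[of "join (\<rho> \<inter> \<sigma>) (\<tau> \<inter> \<sigma>)" \<sigma>] \<sigma> by (simp add: gens_dim)
  then have "vec.dim ((\<rho> \<inter> \<sigma>) \<inter> (\<tau> \<inter> \<sigma>)) > 0"
    using dim_join[OF sub] \<rho> \<tau> by (simp add: base_solid_iff)
  moreover have "(\<rho> \<inter> \<sigma>) \<inter> (\<tau> \<inter> \<sigma>) \<subseteq> {0}" using * by blast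
  then have "vec.dim ((\<rho> \<inter> \<sigma>) \<inter> (\<tau> \<inter> \<sigma>)) = 0" by simp
  ultimately show False by simp
qed

text \<open>Fix a member \<pi>. Every other member shares with it a line through \<open>p\<close>,
  that is q^2 - q vectors outside \<open>p\<close>, and every vector of \<pi> outside
  \<open>p\<close> lies on \<open>q\<close> other members through the line that it spans with
  \<open>p\<close>.\<close>

lemma card_point_pencil:
  assumes p: "p \<in> points Q"
  shows "real (card (point_pencil P p)) = (q + 1) * (q\<^sup>2 + 1)"
proof -
  obtain c where c: "c \<noteq> 0" "Q c = 0" "p = vec.span {c}" by (rule pointsD[OF p])
  have p': "on_quadric Q p" "vec.dim p = 1" "vec.subspace p"
    using c by (simp_all add: on_quadric_span_singleton)
  let ?M = "point_pencil P p"
  obtain \<pi> where \<pi>: "\<pi> \<in> ?M"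
  proof -
    have "vec.dim p \<le> 3" using p' by simp
    with p'(1) obtain \<pi> \<sigma> where "\<pi> \<in> P" "\<sigma> \<in> gens - P" "p \<subseteq> \<pi>" "p \<subseteq> \<sigma>" by (rule gens_through)
    then show ?thesis using that[of \<pi>] by (simp add: point_pencil_def)
  qed
  then have \<pi>P: "\<pi> \<in> P" "c \<in> \<pi>" "p \<subseteq> \<pi>"
    using c(3) pencil_iff[of \<pi> c] by (simp_all add: point_pencil_def)
  note g\<pi> = P_gens[OF \<pi>P(1)]
  have "(\<Sum>\<tau>\<in>?M - {\<pi>}. real (card {v\<in>\<pi> - p. v \<in> \<tau>}))
      = (\<Sum>v\<in>\<pi> - p. real (card {\<tau>\<in>?M - {\<pi>}. v \<in> \<tau>}))"
    by (intro sum_card_swap) simp_all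
  moreover have "real (card {v\<in>\<pi> - p. v \<in> \<tau>}) = q\<^sup>2 - q" if "\<tau> \<in> ?M - {\<pi>}" for \<tau>
  proof -
    have \<tau>: "\<tau> \<in> P" "\<tau> \<noteq> \<pi>" "c \<in> \<tau>" "p \<subseteq> \<tau>"
      using that c(3) pencil_iff[of \<tau> c] by (simp_all add: point_pencil_def)
    have "vec.dim (\<pi> \<inter> \<tau>) = 2" using P_dim_cases[OF \<pi>P(1) \<tau>(1)] \<tau> \<pi>P c(1) by blast
    moreover have "{v\<in>\<pi> - p. v \<in> \<tau>} = \<pi> \<inter> \<tau> - p" by blast
    ultimately show ?thesis
      using card_diff[OF gens_Int_subspace[OF g\<pi> P_gens[OF \<tau>(1)]] p'(3)] \<pi>P \<tau> p' by simp
  qed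
  moreover have "real (card {\<tau>\<in>?M - {\<pi>}. v \<in> \<tau>}) = q" if v: "v \<in> \<pi> - p" for v
  proof -
    let ?l = "vec.span {c, v}"
    have "?l \<subseteq> \<pi>" using v \<pi>P g\<pi> by (intro vec.span_minimal) (auto simp: gens_subspace)
    then have l: "sing_line ?l"
      using dim_pair[OF c(1), of v] v c g\<pi> by (intro sing_lineI) auto
    have "{\<tau>\<in>?M - {\<pi>}. v \<in> \<tau>} = point_pencil P ?l - {\<pi>}"
    proof (rule set_eqI)
      fix \<tau>
      show "\<tau> \<in> {\<tau>\<in>?M - {\<pi>}. v \<in> \<tau>} \<longleftrightarrow> \<tau> \<in> point_pencil P ?l - {\<pi>}"
        using span_insert_subset_iff[OF gens_subspace[OF P_gens], of \<tau> c "{v}"] c(3)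
        by (auto simp: pencil_iff) (auto simp: point_pencil_def)
    qed
    moreover have "\<pi> \<in> point_pencil P ?l" using \<open>?l \<subseteq> \<pi>\<close> \<pi>P by (simp add: point_pencil_def)
    ultimately show ?thesis
      using card_pencil_line[OF l] by (simp only: card_remove)
  qed
  moreover have "real (card (\<pi> - p)) = q^4 - q"
    using card_diff[of \<pi> p] g\<pi> p' \<pi>P by (simp add: gens_subspace gens_dim)
  ultimately have "real (card (?M - {\<pi>})) * (q\<^sup>2 - q) = (q^4 - q) * q" by simp
  moreover have "real (card (?M - {\<pi>})) = real (card ?M) - 1"
    using \<pi> by (simp only: card_remove)
  ultimately have "q * (q - 1) * (real (card ?M) - (q + 1) * (q\<^sup>2 + 1)) = 0"
    by algebra
  then show ?thesis using q_ge_2 by auto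
qed

text \<open>Each \<open>w \<notin> \<sigma>\<close> is perpendicular to exactly one plane of \<open>\<sigma>\<close>, namely \<open>\<sigma> \<inter> w\<^sup>\<bottom>\<close>.\<close>

lemma card_base_solid:
  assumes \<sigma>: "\<sigma> \<in> gens - P"
  shows "real (card (base_solid P \<sigma>)) = (q + 1) * (q\<^sup>2 + 1)"
proof -
  let ?M = "base_solid P \<sigma>"
  have g\<sigma>: "\<sigma> \<in> gens" using \<sigma> by blast
  have M: "\<tau> \<in> P" "vec.dim (\<tau> \<inter> \<sigma>) = 3" "vec.subspace (\<tau> \<inter> \<sigma>)" if "\<tau> \<in> ?M" for \<tau>
    using that gens_Int_subspace[OF P_gens g\<sigma>] by (auto simp: base_solid_iff)
  have "(\<Sum>\<tau>\<in>?M. real (card {w\<in>UNIV - \<sigma>. w \<in> perp (\<tau> \<inter> \<sigma>)}))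
      = (\<Sum>w\<in>UNIV - \<sigma>. real (card {\<tau>\<in>?M. w \<in> perp (\<tau> \<inter> \<sigma>)}))"
    by (intro sum_card_swap) simp_all
  \<comment> \<open>The complement of the plane has dimension 5 and contains \<sigma>, which leaves
    q^5 - q^4 vectors.\<close>
  moreover have "real (card {w\<in>UNIV - \<sigma>. w \<in> perp (\<tau> \<inter> \<sigma>)}) = q^5 - q^4" if "\<tau> \<in> ?M" for \<tau>
  proof -
    have "\<sigma> \<subseteq> perp (\<tau> \<inter> \<sigma>)" using perp_antimono[of "\<tau> \<inter> \<sigma>" \<sigma>] gens_perp[OF g\<sigma>] by blast
    moreover have "vec.dim (perp (\<tau> \<inter> \<sigma>)) = 5" using dim_perp[OF M(3)[OF that]] M(2)[OF that] by simp
    moreover have "{w\<in>UNIV - \<sigma>. w \<in> perp (\<tau> \<inter> \<sigma>)} = perp (\<tau> \<inter> \<sigma>) - \<sigma>" by blast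
    ultimately show ?thesis
      using card_diff[of "perp (\<tau> \<inter> \<sigma>)" \<sigma>] g\<sigma> by (simp add: gens_subspace gens_dim)
  qed
  moreover have "real (card {\<tau>\<in>?M. w \<in> perp (\<tau> \<inter> \<sigma>)}) = 1" if w: "w \<in> UNIV - \<sigma>" for w
  proof -
    let ?E = "\<sigma> \<inter> perp {w}"
    have E: "vec.subspace ?E" using g\<sigma> by (simp add: gens_subspace vec.subspace_inter)
    have "w \<notin> perp \<sigma>" using w g\<sigma> by (simp add: gens_perp)
    then obtain u where "u \<in> \<sigma>" "B w u \<noteq> 0" by (auto simp: perp_def B_commute)
    then have dimE: "vec.dim ?E = 3"
      using dim_meet_perp_singleton[OF gens_subspace[OF g\<sigma>], of u w] g\<sigma> by (simp add: gens_dim)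
    have "on_quadric Q ?E" using g\<sigma> by (simp add: gens_on_quadric on_quadric_Int)
    then obtain \<pi> where \<pi>: "\<And>\<tau>. \<tau> \<in> P \<and> ?E \<subseteq> \<tau> \<longleftrightarrow> \<tau> = \<pi>"
      using ex1_P_through_plane dimE by metis
    have "\<tau> \<in> ?M \<and> w \<in> perp (\<tau> \<inter> \<sigma>) \<longleftrightarrow> \<tau> \<in> P \<and> ?E \<subseteq> \<tau>" for \<tau>
    proof
      assume \<tau>: "\<tau> \<in> ?M \<and> w \<in> perp (\<tau> \<inter> \<sigma>)"
      then have "\<tau> \<inter> \<sigma> \<subseteq> ?E" by (auto simp: perp_def B_commute)
      then have "\<tau> \<inter> \<sigma> = ?E" using M[of \<tau>] \<tau> E dimE by (intro eq_of_dim_le) auto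
      then show "\<tau> \<in> P \<and> ?E \<subseteq> \<tau>" using M[of \<tau>] \<tau> by blast
    next
      assume \<tau>: "\<tau> \<in> P \<and> ?E \<subseteq> \<tau>"
      then have \<tau>M: "\<tau> \<in> ?M" using base_solidI[of \<tau> \<sigma> ?E] \<sigma> dimE by auto
      have "?E = \<tau> \<inter> \<sigma>" using M[OF \<tau>M] \<tau> E dimE by (intro eq_of_dim_le) auto
      then have "w \<in> perp (\<tau> \<inter> \<sigma>)" by (auto simp: perp_def B_commute)
      then show "\<tau> \<in> ?M \<and> w \<in> perp (\<tau> \<inter> \<sigma>)" using \<tau>M by blast
    qed
    then have "{\<tau>\<in>?M. w \<in> perp (\<tau> \<inter> \<sigma>)} = {\<pi>}" using \<pi> by auto
    then show ?thesis by simp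
  qed
  moreover have "real (card (UNIV - \<sigma>)) = q^8 - q^4"
    using card_diff[of UNIV \<sigma>] g\<sigma> by (simp add: gens_subspace gens_dim dim_UNIV_8 del: vec.dim_UNIV)
  ultimately have "real (card ?M) * (q^5 - q^4) = q^8 - q^4" by simp
  then have "q^4 * (q - 1) * (real (card ?M) - (q + 1) * (q\<^sup>2 + 1)) = 0" by algebra
  then show ?thesis using q_ge_2 by auto
qed

text \<open>If \<open>M\<close> and \<open>N\<close> lie in \<open>L\<close>, the two lines are
  disjoint full lines of \<pi>, so for \<pi> in \<open>L\<close> the lemma
  \<open>full_lines_meet\<close> gives x \<ge> q + 1. This excludes overlaps between solids and
  pencils inside \<open>L\<close>.\<close>

definition separated :: "('a^8) set \<Rightarrow> ('a^8) set set \<Rightarrow> ('a^8) set set \<Rightarrow> bool" where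
  "separated \<pi> M N \<longleftrightarrow> (\<exists>l m.
     vec.subspace l \<and> l \<subseteq> \<pi> \<and> vec.dim l = 2 \<and> point_pencil P l \<subseteq> M \<and>
     vec.subspace m \<and> m \<subseteq> \<pi> \<and> vec.dim m = 2 \<and> point_pencil P m \<subseteq> N \<and> l \<inter> m = {0})"

text \<open>Choose \<open>a\<close> outside the line \<open>c d\<close>, so that the line
  \<open>c a\<close> avoids \<open>d\<close>, and then \<open>b\<close> outside the plane spanned by
  \<open>c\<close>, \<open>a\<close>, \<open>d\<close>. The lines \<open>c a\<close> and
  \<open>d b\<close> are disjoint.\<close>

lemma pencil_pencil_lines:
  assumes p: "p \<in> points Q" and p': "p' \<in> points Q" and ne: "p \<noteq> p'"
    and \<pi>: "\<pi> \<in> point_pencil P p" "\<pi> \<in> point_pencil P p'"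
  shows "separated \<pi> (point_pencil P p) (point_pencil P p')"
proof -
  obtain c where c: "c \<noteq> 0" "Q c = 0" "p = vec.span {c}" by (rule pointsD[OF p])
  obtain d where d: "d \<noteq> 0" "Q d = 0" "p' = vec.span {d}" by (rule pointsD[OF p'])
  have \<pi>P: "\<pi> \<in> P" "c \<in> \<pi>" "d \<in> \<pi>" using \<pi> c d by (simp_all add: pencil_iff)
  note \<pi>s = gens_subspace[OF P_gens[OF \<pi>P(1)]] and \<pi>d = gens_dim[OF P_gens[OF \<pi>P(1)]]
  have dc: "d \<notin> vec.span {c}"
  proof
    assume "d \<in> vec.span {c}"
    then have "p' = p" unfolding c(3) d(3) using c d
      by (intro eq_of_dim_le vec.span_minimal) auto
    then show False using ne by simp
  qed
  have "vec.dim (vec.span {c, d}) < vec.dim \<pi>" using dim_pair[OF c(1) dc] \<pi>d by simp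
  then have "\<not> \<pi> \<subseteq> vec.span {c, d}" using vec.dim_subset leD by blast
  then obtain a where a: "a \<in> \<pi>" "a \<notin> vec.span {c, d}" by blast
  have ac: "a \<notin> vec.span {c}" using a vec.span_mono[of "{c}" "{c, d}"] by blast
  let ?l = "vec.span {c, a}"
  have l: "vec.subspace ?l" "?l \<subseteq> \<pi>" "vec.dim ?l = 2"
    using dim_pair[OF c(1) ac] \<pi>P a \<pi>s by (simp_all add: span_pair_subset)
  have dl: "d \<notin> ?l"
    using a dc vec.in_span_insert[of d a "{c}"] by (metis insert_commute)
  have "vec.dim (vec.span (insert d ?l)) < vec.dim \<pi>" using dim_span_insert[OF l(1) dl] l \<pi>d by simp
  then have "\<not> \<pi> \<subseteq> vec.span (insert d ?l)" using vec.dim_subset leD by blast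
  then obtain b where b: "b \<in> \<pi>" "b \<notin> vec.span (insert d ?l)" by blast
  let ?m = "vec.span {d, b}"
  have "b \<notin> vec.span {d}" using b vec.span_mono[of "{d}" "insert d ?l"] by blast
  then have m: "vec.subspace ?m" "?m \<subseteq> \<pi>" "vec.dim ?m = 2"
    using dim_pair[OF d(1)] \<pi>P b \<pi>s by (simp_all add: span_pair_subset)
  have "?l \<inter> ?m = {0}" by (rule disjoint_span_pair[OF l(1) dl b(2)])
  moreover have "p \<subseteq> ?l" "p' \<subseteq> ?m" unfolding c(3) d(3) by (auto intro!: vec.span_mono)
  then have "point_pencil P ?l \<subseteq> point_pencil P p" "point_pencil P ?m \<subseteq> point_pencil P p'"
    unfolding point_pencil_def by blast+
  ultimately show ?thesis unfolding separated_def using l m by blast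
qed

lemma pencil_line_subset_base_solid:
  assumes "\<sigma> \<in> gens - P" "l \<subseteq> \<sigma>" "vec.dim l = 2"
  shows "point_pencil P l \<subseteq> base_solid P \<sigma>"
  using base_solidI[OF _ assms(1) _ assms(2)] assms(3) by (auto simp: point_pencil_def)

text \<open>All members of \<open>P\<close> through a line of \<sigma> belong to the base-solid, so
  any line of the plane \<pi> \<inter> \<sigma> that is disjoint from \<open>l\<close> serves as
  \<open>m\<close>.\<close>

lemma base_solid_line:
  assumes \<sigma>: "\<sigma> \<in> gens - P" and \<pi>: "\<pi> \<in> base_solid P \<sigma>"
    and l: "vec.subspace l" "vec.dim l = 2" "l \<subseteq> \<pi>" "\<not> l \<subseteq> \<sigma>"
  obtains m where "vec.subspace m" "m \<subseteq> \<pi>" "vec.dim m = 2" "point_pencil P m \<subseteq> base_solid P \<sigma>"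
    "l \<inter> m = {0}"
proof -
  have E: "vec.subspace (\<pi> \<inter> \<sigma>)" "vec.dim (\<pi> \<inter> \<sigma>) = 3"
    using \<pi> \<sigma> gens_Int_subspace P_gens by (auto simp: base_solid_iff)
  have "\<not> l \<subseteq> \<pi> \<inter> \<sigma>" using l by blast
  then obtain m where m: "vec.subspace m" "vec.dim m = 2" "m \<subseteq> \<pi> \<inter> \<sigma>" "l \<inter> m = {0}"
    by (rule disjoint_line_in_plane[OF E l(1,2)])
  then show ?thesis using that[of m] pencil_line_subset_base_solid[OF \<sigma>, of m] by blast
qed

text \<open>Choose a line of \<pi> through \<open>p\<close> that leaves \<sigma>: if
  \<open>p\<close> is in \<sigma>, a second point outside \<sigma> is taken, otherwise any second
  point. Then apply \<open>base_solid_line\<close>.\<close>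

lemma pencil_base_solid_lines:
  assumes p: "p \<in> points Q" and \<sigma>: "\<sigma> \<in> gens - P"
    and \<pi>: "\<pi> \<in> point_pencil P p" "\<pi> \<in> base_solid P \<sigma>"
  shows "separated \<pi> (point_pencil P p) (base_solid P \<sigma>)"
proof -
  obtain c where c: "c \<noteq> 0" "Q c = 0" "p = vec.span {c}" by (rule pointsD[OF p])
  have \<pi>P: "\<pi> \<in> P" "c \<in> \<pi>" using \<pi> c by (simp_all add: pencil_iff)
  note \<pi>s = gens_subspace[OF P_gens[OF \<pi>P(1)]] and \<pi>d = gens_dim[OF P_gens[OF \<pi>P(1)]]
  let ?E = "\<pi> \<inter> \<sigma>"
  have E: "vec.subspace ?E" "vec.dim ?E = 3"
    using \<pi> \<sigma> gens_Int_subspace P_gens by (auto simp: base_solid_iff)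
  obtain v where v: "v \<in> \<pi>" "v \<notin> vec.span {c}" "c \<notin> \<sigma> \<or> v \<notin> \<sigma>"
  proof (cases "c \<in> \<sigma>")
    case True
    have "\<not> \<pi> \<subseteq> ?E" using vec.dim_subset[of \<pi> ?E] \<pi>d E by auto
    then obtain v where v: "v \<in> \<pi>" "v \<notin> \<sigma>" by blast
    moreover have "vec.span {c} \<subseteq> \<sigma>" using True \<sigma> by (intro vec.span_minimal) (auto simp: gens_subspace)
    ultimately show ?thesis using that[of v] by blast
  next
    case False
    have "\<not> \<pi> \<subseteq> vec.span {c}" using vec.dim_subset[of \<pi> "vec.span {c}"] \<pi>d c by auto
    then show ?thesis using that False by blast
  qed
  let ?l = "vec.span {c, v}"
  have l: "vec.subspace ?l" "?l \<subseteq> \<pi>" "vec.dim ?l = 2"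
    using dim_pair[OF c(1) v(2)] \<pi>P v \<pi>s by (simp_all add: span_pair_subset)
  have "\<not> ?l \<subseteq> \<sigma>" using v(3) vec.span_base[of _ "{c, v}"] by blast
  then obtain m where m: "vec.subspace m" "m \<subseteq> \<pi>" "vec.dim m = 2"
      "point_pencil P m \<subseteq> base_solid P \<sigma>" "?l \<inter> m = {0}"
    by (rule base_solid_line[OF \<sigma> \<pi>(2) l(1,3,2)])
  have "p \<subseteq> ?l" unfolding c(3) by (auto intro!: vec.span_mono)
  then have "point_pencil P ?l \<subseteq> point_pencil P p" unfolding point_pencil_def by blast
  then show ?thesis unfolding separated_def using l m by blast
qed

text \<open>The plane \<pi> \<inter> \<sigma> is not in \<sigma>', as generators of one class
  sharing a plane are equal. A line of this plane through a point \<open>a\<close> outside \<sigma>'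
  can be fed into \<open>base_solid_line\<close>.\<close>

lemma base_solid_base_solid_lines:
  assumes \<sigma>: "\<sigma> \<in> gens - P" and \<sigma>': "\<sigma>' \<in> gens - P" and ne: "\<sigma> \<noteq> \<sigma>'"
    and \<pi>: "\<pi> \<in> base_solid P \<sigma>" "\<pi> \<in> base_solid P \<sigma>'"
  shows "separated \<pi> (base_solid P \<sigma>) (base_solid P \<sigma>')"
proof -
  let ?E = "\<pi> \<inter> \<sigma>" and ?E' = "\<pi> \<inter> \<sigma>'"
  have E: "vec.subspace ?E" "vec.dim ?E = 3"
    using \<pi> \<sigma> gens_Int_subspace P_gens by (auto simp: base_solid_iff)
  have "\<not> ?E \<subseteq> \<sigma>'"
  proof
    assume "?E \<subseteq> \<sigma>'"
    then have "\<sigma> = \<sigma>'" using not_P_eqI[OF \<sigma> \<sigma>', of ?E] E by auto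
    then show False using ne by simp
  qed
  then obtain a where a: "a \<in> ?E" "a \<notin> \<sigma>'" by blast
  have "vec.span {a} \<subseteq> ?E" using a(1) E(1) by (intro vec.span_minimal) auto
  moreover have "vec.dim (vec.span {a}) \<le> 2" by simp
  ultimately obtain l where l: "vec.subspace l" "vec.span {a} \<subseteq> l" "l \<subseteq> ?E" "vec.dim l = 2"
    using subspace_between[of "vec.span {a}" ?E 2] E by auto
  have "\<not> l \<subseteq> \<sigma>'" using l(2) a vec.span_base[of a "{a}"] by blast
  moreover have "l \<subseteq> \<pi>" using l by blast
  ultimately obtain m where m: "vec.subspace m" "m \<subseteq> \<pi>" "vec.dim m = 2"
      "point_pencil P m \<subseteq> base_solid P \<sigma>'" "l \<inter> m = {0}"
    using base_solid_line[OF \<sigma>' \<pi>(2) l(1,4)] by metis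
  have "point_pencil P l \<subseteq> base_solid P \<sigma>"
    using pencil_line_subset_base_solid[OF \<sigma>, of l] l by blast
  then show ?thesis unfolding separated_def using l(1,4) \<open>l \<subseteq> \<pi>\<close> m by blast
qed

text \<open>If \<open>p\<close> lies in \<sigma>, take the member of \<open>P\<close> through a
  plane of \<sigma> on \<open>p\<close>. Otherwise the projection of \<sigma> from \<open>p\<close>
  differs from \<sigma> and shares the plane \<sigma> \<inter> perp p with it, so it is in
  \<open>P\<close>.\<close>

lemma pencil_meets_base_solid:
  assumes p: "p \<in> points Q" and \<sigma>: "\<sigma> \<in> gens - P"
  obtains \<pi> where "\<pi> \<in> point_pencil P p" "\<pi> \<in> base_solid P \<sigma>"
proof -
  obtain c where c: "c \<noteq> 0" "Q c = 0" "p = vec.span {c}" by (rule pointsD[OF p])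
  have p': "on_quadric Q p" "vec.dim p = 1" "vec.subspace p"
    using c by (simp_all add: on_quadric_span_singleton)
  have g\<sigma>: "\<sigma> \<in> gens" using \<sigma> by blast
  show ?thesis
  proof (cases "p \<subseteq> \<sigma>")
    case True
    obtain E where E: "vec.subspace E" "p \<subseteq> E" "E \<subseteq> \<sigma>" "vec.dim E = 3"
      using subspace_between[of p \<sigma> 3] True p' g\<sigma> by (auto simp: gens_subspace gens_dim)
    have "on_quadric Q E" using E g\<sigma> gens_on_quadric on_quadric_subset by blast
    then obtain \<pi> where "\<pi> \<in> P" "E \<subseteq> \<pi>" using ex1_P_through_plane E by blast
    then show ?thesis using that[of \<pi>] base_solidI[of \<pi> \<sigma> E] \<sigma> E by (auto simp: point_pencil_def)
  next
    case False
    let ?E = "\<sigma> \<inter> perp p"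
    let ?\<pi> = "join p ?E"
    have E: "vec.subspace ?E" using g\<sigma> by (simp add: gens_subspace vec.subspace_inter)
    have \<pi>: "?\<pi> \<in> gens" using gen_through[OF p'(1) g\<sigma>] .
    have p\<pi>: "p \<subseteq> ?\<pi>" and E\<pi>: "?E \<subseteq> ?\<pi>" by (rule join_upper1[OF E], rule join_upper2[OF p'(3)])
    have ge: "vec.dim ?E \<ge> 3" using dim_gen_meet_perp[OF g\<sigma> p'(3)] p'(2) by simp
    have "vec.dim (\<sigma> \<inter> ?\<pi>) \<ge> 3" using vec.dim_subset[of ?E "\<sigma> \<inter> ?\<pi>"] E\<pi> ge by auto
    moreover have "\<not> vec.dim (\<sigma> \<inter> ?\<pi>) \<ge> 4" using gens_eqI[OF g\<sigma> \<pi>] p\<pi> False by auto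
    ultimately have dim: "vec.dim (\<sigma> \<inter> ?\<pi>) = 3" by linarith
    then have "?\<pi> \<in> P" using P_memI_odd[OF \<sigma> \<pi>] by simp
    then show ?thesis
      using that[of ?\<pi>] p\<pi> dim by (simp add: point_pencil_def base_solid_iff Int_commute)
  qed
qed

text \<open>The joining line is totally singular and therefore lies in some member of
  \<open>P\<close>. This makes disjoint pencils have non-collinear vertices.\<close>

lemma pencils_meet:
  assumes p: "p \<in> points Q" and p': "p' \<in> points Q" and col: "quadric_collinear Q p p'"
  obtains \<pi> where "\<pi> \<in> point_pencil P p" "\<pi> \<in> point_pencil P p'"
proof -
  obtain c where c: "c \<noteq> 0" "Q c = 0" "p = vec.span {c}" by (rule pointsD[OF p])
  obtain d where d: "d \<noteq> 0" "Q d = 0" "p' = vec.span {d}" by (rule pointsD[OF p'])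
  have "p \<union> p' \<subseteq> vec.span {c, d}"
    unfolding c(3) d(3) by (simp add: vec.span_mono)
  then have "vec.span (p \<union> p') \<subseteq> vec.span {c, d}" by (intro vec.span_minimal) simp_all
  then have "vec.dim (vec.span (p \<union> p')) \<le> card {c, d}"
    by (metis vec.dim_le_card finite.emptyI finite.insertI)
  also have "card {c, d} \<le> 3" by (simp add: card_insert_if)
  finally obtain \<pi> \<sigma> where "\<pi> \<in> P" "\<sigma> \<in> gens - P" "vec.span (p \<union> p') \<subseteq> \<pi>" "vec.span (p \<union> p') \<subseteq> \<sigma>"
    using gens_through[of "vec.span (p \<union> p')"] col unfolding quadric_collinear_def by metis
  then show ?thesis
    using that[of \<pi>] vec.span_superset[of "p \<union> p'"] by (auto simp: point_pencil_def)
qed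

text \<open>By parity the centers share a line. Extend it to a plane of \<sigma>: the member of
  \<open>P\<close> through that plane also contains the line of \<sigma>' and hence shares a plane
  with \<sigma>'.\<close>

lemma base_solids_meet:
  assumes \<sigma>: "\<sigma> \<in> gens - P" and \<sigma>': "\<sigma>' \<in> gens - P" and ne: "\<sigma> \<noteq> \<sigma>'" and meet: "\<sigma> \<inter> \<sigma>' \<noteq> {0}"
  obtains \<pi> where "\<pi> \<in> base_solid P \<sigma>" "\<pi> \<in> base_solid P \<sigma>'"
proof -
  have g: "\<sigma> \<in> gens" "\<sigma>' \<in> gens" using \<sigma> \<sigma>' by auto
  let ?l = "\<sigma> \<inter> \<sigma>'"
  have ls: "vec.subspace ?l" using gens_Int_subspace[OF g] .
  have "even (vec.dim ?l)" using even_dim_notP \<sigma> \<sigma>' by blast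
  moreover have "vec.dim ?l \<noteq> 0" using dim_zero_iff[OF ls] meet by blast
  moreover have "\<not> vec.dim ?l \<ge> 4" using gens_eqI[OF g] ne by blast
  moreover have "n < 4 \<Longrightarrow> n \<noteq> 0 \<Longrightarrow> even n \<Longrightarrow> n = 2" for n :: nat by presburger
  ultimately have dim: "vec.dim ?l = 2" by (meson not_le)
  obtain E where E: "vec.subspace E" "?l \<subseteq> E" "E \<subseteq> \<sigma>" "vec.dim E = 3"
    using subspace_between[of ?l \<sigma> 3] ls g dim by (auto simp: gens_subspace gens_dim)
  have "on_quadric Q E" using E g gens_on_quadric on_quadric_subset by blast
  then obtain \<pi> where "\<pi> \<in> P" "E \<subseteq> \<pi>" using ex1_P_through_plane E by blast
  then show ?thesis
    using that[of \<pi>] base_solidI[of \<pi> \<sigma> E] base_solidI[of \<pi> \<sigma>' ?l] \<sigma> \<sigma>' E dim by auto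
qed

end

section \<open>Point-pencils and base-solids inside a Cameron-Liebler set\<close>

context cameron_liebler begin

text \<open>\<open>M\<close> stands for a point-pencil or a base-solid. A member \<rho> of
  \<open>M\<close> outside \<open>L\<close> would meet \<pi> and all its neighbours along full
  lines, but it meets only x(q^2 + q + 1) members of \<open>L\<close>; this contradicts
  \<open>card_full_neighbours\<close>.\<close>

lemma subset_of_meeting_family:
  assumes \<pi>: "\<pi> \<in> L" and x: "2 * x \<le> q + 2"
    and M: "\<pi> \<in> M" "M \<subseteq> P" "\<And>\<rho> \<tau>. \<rho> \<in> M \<Longrightarrow> \<tau> \<in> M \<Longrightarrow> \<rho> \<inter> \<tau> \<noteq> {0}"
    and full: "\<And>\<tau>. \<tau> \<in> meeting \<pi> - {\<pi>} \<Longrightarrow> point_pencil P (\<pi> \<inter> \<tau>) \<subseteq> L \<Longrightarrow> \<tau> \<in> M"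
  shows "M \<subseteq> L"
proof
  fix \<rho> assume \<rho>: "\<rho> \<in> M"
  show "\<rho> \<in> L"
  proof (rule ccontr)
    assume \<rho>L: "\<rho> \<notin> L"
    let ?F = "{\<tau>\<in>meeting \<pi> - {\<pi>}. point_pencil P (\<pi> \<inter> \<tau>) \<subseteq> L}"
    have xq: "x < q + 1" using x q_ge_2 by simp
    have "insert \<pi> ?F \<subseteq> meeting \<rho>"
      using M(1) M(3)[OF \<rho>] \<pi> full by (auto simp: meeting_def)
    then have "card (insert \<pi> ?F) \<le> card (meeting \<rho>)" by (intro card_mono) simp_all
    then have "real (card ?F) \<le> real (card (meeting \<rho>)) - 1" by simp
    then have "real (card ?F) \<le> x * (q\<^sup>2 + q + 1) - 1"
      using card_meeting[of \<rho>] \<rho> \<rho>L M(2) by auto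
    then have "(q + 1 - x) * real (card ?F) \<le> (q + 1 - x) * (x * (q\<^sup>2 + q + 1) - 1)"
      using xq by (intro mult_left_mono) auto
    then have "q * (x * (q\<^sup>2 + q + 1) + q^3 - 1) - (x - 1) * q * (2 * q\<^sup>2 + x * (q + 1))
        \<le> (q + 1 - x) * (x * (q\<^sup>2 + q + 1) - 1)"
      using card_full_neighbours[OF \<pi> xq] by linarith
    \<comment> \<open>Both summands are nonnegative and thus zero. The square then gives x = 1, for
      which the first summand is q^4.\<close>
    then have "q^3 * (q + 2 - 2 * x) + (x - 1)\<^sup>2 \<le> 0"
      by (simp add: algebra_simps power2_eq_square power3_eq_cube)
    moreover have "q^3 * (q + 2 - 2 * x) \<ge> 0" using x q_ge_2 by simp
    moreover have "(x - 1)\<^sup>2 \<ge> 0" by simp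
    ultimately have eq: "q^3 * (q + 2 - 2 * x) = 0" "(x - 1)\<^sup>2 = 0" by linarith+
    from eq(2) have "x = 1" by simp
    then show False using eq(1) q_ge_2 by simp
  qed
qed

text \<open>The full lines of \<pi> pairwise meet, so they share a point, which becomes a vertex, or
  lie in a plane, whose generator of the other class becomes a center. Either choice satisfies
  \<open>subset_of_meeting_family\<close>.\<close>

lemma member_in_solid:
  assumes \<pi>: "\<pi> \<in> L" and x: "2 * x \<le> q + 2"
  shows "(\<exists>p\<in>points Q. \<pi> \<in> point_pencil P p \<and> point_pencil P p \<subseteq> L)
    \<or> (\<exists>\<sigma>\<in>gens - P. \<pi> \<in> base_solid P \<sigma> \<and> base_solid P \<sigma> \<subseteq> L)"
proof -
  have \<pi>P: "\<pi> \<in> P" using \<pi> L_subset by blast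
  note g\<pi> = P_gens[OF \<pi>P]
  note \<pi>s = gens_subspace[OF g\<pi>]
  have xq: "\<not> q + 1 \<le> x" using x q_ge_2 by simp
  let ?F = "{l. vec.subspace l \<and> l \<subseteq> \<pi> \<and> vec.dim l = 2 \<and> point_pencil P l \<subseteq> L}"
  have inF: "\<pi> \<inter> \<tau> \<in> ?F" "\<tau> \<in> P" if "\<tau> \<in> meeting \<pi> - {\<pi>}" "point_pencil P (\<pi> \<inter> \<tau>) \<subseteq> L" for \<tau>
  proof -
    show \<tau>: "\<tau> \<in> P" using that L_subset by (auto simp: meeting_def)
    have "\<pi> \<noteq> \<tau>" "\<pi> \<inter> \<tau> \<noteq> {0}" using that(1) by (auto simp: meeting_def)
    then have "vec.dim (\<pi> \<inter> \<tau>) = 2" by (rule P_dim_cases[OF \<pi>P \<tau>])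
    then show "\<pi> \<inter> \<tau> \<in> ?F"
      using that(2) gens_Int_subspace[OF g\<pi> P_gens[OF \<tau>]] by simp
  qed
  have meet: "l \<inter> m \<noteq> {0}" if "l \<in> ?F" "m \<in> ?F" for l m
    using full_lines_meet[OF \<pi>, of l m] that xq by blast
  show ?thesis
  \<comment> \<open>If \<pi> has no full line, the first case holds vacuously for any point; the
    second case thus comes with a full line.\<close>
  proof (cases "\<exists>c. c \<noteq> 0 \<and> c \<in> \<pi> \<and> (\<forall>l\<in>?F. c \<in> l)")
    case True
    then obtain c where c: "c \<noteq> 0" "c \<in> \<pi>" "\<And>l. l \<in> ?F \<Longrightarrow> c \<in> l" by blast
    have p: "vec.span {c} \<in> points Q"
      using c g\<pi> by (intro pointsI) (auto simp: on_quadric_Q[OF gens_on_quadric])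
    have "point_pencil P (vec.span {c}) \<subseteq> L"
    proof (rule subset_of_meeting_family[OF \<pi> x])
      fix \<tau> assume "\<tau> \<in> meeting \<pi> - {\<pi>}" "point_pencil P (\<pi> \<inter> \<tau>) \<subseteq> L"
      from inF[OF this] show "\<tau> \<in> point_pencil P (vec.span {c})" using c(3) by (auto simp: pencil_iff)
    next
      show "\<pi> \<in> point_pencil P (vec.span {c})" using \<pi>P c by (simp add: pencil_iff)
      show "point_pencil P (vec.span {c}) \<subseteq> P" by (auto simp: point_pencil_def)
    qed (rule pencil_members_meet[OF p])
    moreover have "\<pi> \<in> point_pencil P (vec.span {c})" using \<pi>P c by (simp add: pencil_iff)
    ultimately show ?thesis using p by blast
  next
    case False
    have "\<pi> \<noteq> {0}" using gens_dim[OF g\<pi>] by auto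
    then obtain c\<^sub>0 where "c\<^sub>0 \<in> \<pi>" "c\<^sub>0 \<noteq> 0" using vec.subspace_0[OF \<pi>s] by blast
    then have ne: "?F \<noteq> {}" using False by blast
    then obtain l\<^sub>0 where l\<^sub>0: "l\<^sub>0 \<in> ?F" by blast
    have nostar: "\<exists>l\<in>?F. c \<notin> l" if "c \<noteq> 0" for c
    proof (cases "c \<in> \<pi>")
      case True
      then show ?thesis using False that by blast
    next
      case False
      then show ?thesis using l\<^sub>0 by blast
    qed
    have lines: "vec.subspace l \<and> vec.dim l = 2" if "l \<in> ?F" for l using that by blast
    obtain l m where lm: "l \<in> ?F" "m \<in> ?F" "vec.dim (join l m) = 3" "\<forall>k\<in>?F. k \<subseteq> join l m"
      by (rule pairwise_meeting_lines[of ?F, OF lines meet nostar ne])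
    let ?E = "join l m"
    have E\<pi>: "?E \<subseteq> \<pi>" using lm \<pi>s by (intro join_least) auto
    have "on_quadric Q ?E"
      using lm E\<pi> by (intro on_quadric_subset[OF gens_on_quadric[OF g\<pi>]]) (auto simp: subspace_join)
    then obtain \<rho> \<sigma> where "\<rho> \<in> P" and \<sigma>: "\<sigma> \<in> gens - P" and "?E \<subseteq> \<rho>" and E\<sigma>: "?E \<subseteq> \<sigma>"
      using lm(3) by (rule gens_through_plane)
    have \<pi>M: "\<pi> \<in> base_solid P \<sigma>" using base_solidI[OF \<pi>P \<sigma> E\<pi> E\<sigma>] lm(3) by simp
    have "base_solid P \<sigma> \<subseteq> L"
    proof (rule subset_of_meeting_family[OF \<pi> x \<pi>M])
      fix \<tau> assume "\<tau> \<in> meeting \<pi> - {\<pi>}" "point_pencil P (\<pi> \<inter> \<tau>) \<subseteq> L"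
      from inF[OF this] have \<tau>: "\<pi> \<inter> \<tau> \<in> ?F" "\<tau> \<in> P" by blast+
      have "\<pi> \<inter> \<tau> \<subseteq> \<sigma>" using bspec[OF lm(4) \<tau>(1)] E\<sigma> by (rule subset_trans)
      then show "\<tau> \<in> base_solid P \<sigma>" using base_solidI[OF \<tau>(2) \<sigma>, of "\<pi> \<inter> \<tau>"] \<tau>(1) by simp
    next
      show "base_solid P \<sigma> \<subseteq> P" by (auto simp: base_solid_def)
    qed (rule base_solid_members_meet[OF \<sigma>])
    then show ?thesis using \<sigma> \<pi>M by blast
  qed
qed

text \<open>The blocks have the size of \<open>L\<close> divided by \<open>x\<close>, so their
  number is \<open>x\<close>; in particular the parameter turns out to be an integer.\<close>

lemma card_disjoint_union:
  assumes L: "L = (\<Union>i\<in>I. M i)" and fin: "finite I"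
    and disj: "\<And>i j. i \<in> I \<Longrightarrow> j \<in> I \<Longrightarrow> i \<noteq> j \<Longrightarrow> M i \<inter> M j = {}"
    and card: "\<And>i. i \<in> I \<Longrightarrow> real (card (M i)) = (q + 1) * (q\<^sup>2 + 1)"
  shows "real (card I) = x"
proof -
  have "card (\<Union>i\<in>I. M i) = (\<Sum>i\<in>I. card (M i))"
    using fin disj by (intro card_UN_disjoint) simp_all
  then have "card L = (\<Sum>i\<in>I. card (M i))" by (simp only: L)
  then have "real (card L) = real (card I) * ((q + 1) * (q\<^sup>2 + 1))" using card by simp
  then have "((q + 1) * (q\<^sup>2 + 1)) * (real (card I) - x) = 0"
    using card_L by (simp add: algebra_simps)
  moreover have "(q + 1) * (q\<^sup>2 + 1) \<noteq> 0" using q_ge_2 by (auto simp: add_nonneg_eq_0_iff)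
  ultimately show ?thesis by simp
qed

lemma classification:
  assumes x: "2 * x \<le> q + 2"
  shows "(\<exists>V. V \<subseteq> points Q \<and> real (card V) = x
            \<and> pairwise (\<lambda>p r. \<not> quadric_collinear Q p r) V
            \<and> L = (\<Union>p\<in>V. point_pencil P p))
       \<or> (\<exists>C. C \<subseteq> generators Q - P \<and> real (card C) = x
            \<and> pairwise proj_disjoint C
            \<and> L = (\<Union>\<pi>\<in>C. base_solid P \<pi>))"
proof -
  \<comment> \<open>All vertices and all centers whose pencil or solid lies in \<open>L\<close>: by
    \<open>member_in_solid\<close> these families cover \<open>L\<close> without any choice.\<close>
  let ?V = "{p\<in>points Q. point_pencil P p \<subseteq> L}"
  let ?C = "{\<sigma>\<in>gens - P. base_solid P \<sigma> \<subseteq> L}"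
  have xq: "\<not> q + 1 \<le> x" using x q_ge_2 by simp
  have no_lines: False
    if sep: "separated \<pi> M N" and MN: "\<pi> \<in> M" "M \<subseteq> L" "N \<subseteq> L" for \<pi> M N
  proof -
    obtain l m where lm: "vec.subspace l" "l \<subseteq> \<pi>" "vec.dim l = 2" "point_pencil P l \<subseteq> M"
        "vec.subspace m" "m \<subseteq> \<pi>" "vec.dim m = 2" "point_pencil P m \<subseteq> N" "l \<inter> m = {0}"
      using sep unfolding separated_def by (elim exE conjE)
    have "q + 1 \<le> x"
      using full_lines_meet[OF _ lm(1-3) _ lm(5-7) _ lm(9)] lm(4,8) MN by blast
    then show False using xq by blast
  qed
  have VV: "point_pencil P p \<inter> point_pencil P p' = {}" if pV: "p \<in> ?V" "p' \<in> ?V" "p \<noteq> p'" for p p'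
  proof (rule ccontr)
    assume "\<not> ?thesis"
    then obtain \<pi> where \<pi>: "\<pi> \<in> point_pencil P p" "\<pi> \<in> point_pencil P p'" by blast
    have pts: "p \<in> points Q" "p' \<in> points Q" using pV by auto
    have "point_pencil P p \<subseteq> L" "point_pencil P p' \<subseteq> L" using pV by auto
    then show False by (rule no_lines[OF pencil_pencil_lines[OF pts pV(3) \<pi>] \<pi>(1)])
  qed
  have VC: False if pV: "p \<in> ?V" and \<sigma>C: "\<sigma> \<in> ?C" for p \<sigma>
  proof -
    have *: "p \<in> points Q" "\<sigma> \<in> gens - P" using pV \<sigma>C by auto
    have **: "point_pencil P p \<subseteq> L" "base_solid P \<sigma> \<subseteq> L" using pV \<sigma>C by auto
    obtain \<pi> where \<pi>: "\<pi> \<in> point_pencil P p" "\<pi> \<in> base_solid P \<sigma>"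
      by (rule pencil_meets_base_solid[OF *])
    from ** show False by (rule no_lines[OF pencil_base_solid_lines[OF * \<pi>] \<pi>(1)])
  qed
  have CC: "base_solid P \<sigma> \<inter> base_solid P \<sigma>' = {}" if \<sigma>C: "\<sigma> \<in> ?C" "\<sigma>' \<in> ?C" "\<sigma> \<noteq> \<sigma>'" for \<sigma> \<sigma>'
  proof (rule ccontr)
    assume "\<not> ?thesis"
    then obtain \<pi> where \<pi>: "\<pi> \<in> base_solid P \<sigma>" "\<pi> \<in> base_solid P \<sigma>'" by blast
    have *: "\<sigma> \<in> gens - P" "\<sigma>' \<in> gens - P" using \<sigma>C by auto
    have "base_solid P \<sigma> \<subseteq> L" "base_solid P \<sigma>' \<subseteq> L" using \<sigma>C by auto
    then show False by (rule no_lines[OF base_solid_base_solid_lines[OF * \<sigma>C(3) \<pi>] \<pi>(1)])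
  qed
  have cover: "L = (\<Union>p\<in>?V. point_pencil P p) \<union> (\<Union>\<sigma>\<in>?C. base_solid P \<sigma>)"
    using member_in_solid[OF _ x] by blast
  show ?thesis
  \<comment> \<open>One center excludes all vertices by \<open>VC\<close>. The empty set
    \<open>L\<close> falls under the first case, with no vertices and x = 0.\<close>
  proof (cases "?C = {}")
    case True
    then have L: "L = (\<Union>p\<in>?V. point_pencil P p)" using cover by blast
    have "real (card ?V) = x"
      by (rule card_disjoint_union[OF L _ VV]) (auto simp: card_point_pencil)
    moreover have "pairwise (\<lambda>p r. \<not> quadric_collinear Q p r) ?V"
    proof (rule pairwiseI, rule notI)
      fix p r assume p: "p \<in> ?V" and r: "r \<in> ?V" and ne: "p \<noteq> r" and col: "quadric_collinear Q p r"
      have "p \<in> points Q" "r \<in> points Q" using p r by auto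
      then obtain \<pi> where "\<pi> \<in> point_pencil P p" "\<pi> \<in> point_pencil P r"
        using col by (rule pencils_meet)
      then show False using VV[OF p r ne] by blast
    qed
    ultimately show ?thesis using L by (intro disjI1 exI[of _ ?V]) blast
  next
    case False
    then have "?V = {}" using VC by blast
    then have L: "L = (\<Union>\<sigma>\<in>?C. base_solid P \<sigma>)" using cover by blast
    have "real (card ?C) = x"
      by (rule card_disjoint_union[OF L _ CC]) (auto simp: card_base_solid)
    moreover have "pairwise proj_disjoint ?C"
    proof (rule pairwiseI, rule ccontr)
      fix \<sigma> \<sigma>' assume \<sigma>: "\<sigma> \<in> ?C" and \<sigma>': "\<sigma>' \<in> ?C" and ne: "\<sigma> \<noteq> \<sigma>'" and "\<not> proj_disjoint \<sigma> \<sigma>'"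
      then have meet: "\<sigma> \<inter> \<sigma>' \<noteq> {0}" by (simp add: proj_disjoint_def)
      have "\<sigma> \<in> gens - P" "\<sigma>' \<in> gens - P" using \<sigma> \<sigma>' by auto
      then obtain \<pi> where "\<pi> \<in> base_solid P \<sigma>" "\<pi> \<in> base_solid P \<sigma>'"
        using ne meet by (rule base_solids_meet)
      then show False using CC[OF \<sigma> \<sigma>' ne] by blast
    qed
    ultimately show ?thesis using L by (intro disjI2 exI[of _ ?C]) blast
  qed
qed

end

theorem theorem6p12:
  fixes Q :: "'a::{field,finite}^8 \<Rightarrow> 'a"
    and P L :: "('a^8) set set"
    and x :: real
  assumes "hyperbolic_quadric Q"
    and "P \<in> generator_classes Q"
    and "\<exists>S. spread Q S \<and> S \<subseteq> P"
    and "cameron_liebler_set P L x"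
    and "x \<le> (sqrt 3 - 1) / 2 * real CARD('a)"
  shows "(\<exists>V. V \<subseteq> points Q \<and> real (card V) = x
            \<and> pairwise (\<lambda>p r. \<not> quadric_collinear Q p r) V
            \<and> L = (\<Union>p\<in>V. point_pencil P p))
       \<or> (\<exists>C. C \<subseteq> generators Q - P \<and> real (card C) = x
            \<and> pairwise proj_disjoint C
            \<and> L = (\<Union>\<pi>\<in>C. base_solid P \<pi>))"
proof -
  have CL: "cameron_liebler Q (real CARD('a)) P L x"
    by (intro cameron_liebler.intro generator_class.intro hyperbolic_space.intro
        generator_class_axioms.intro cameron_liebler_axioms.intro assms refl)
  \<comment> \<open>The factor (sqrt 3 - 1) / 2 is at most 1 / 2, so the bound gives 2 x \<le>
    q.\<close>
  have "sqrt 3 \<le> 2" by (rule real_le_lsqrt) simp_all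
  then have "(sqrt 3 - 1) / 2 * real CARD('a) \<le> 1 / 2 * real CARD('a)"
    by (intro mult_right_mono) auto
  then have "2 * x \<le> real CARD('a) + 2" using assms(5) by linarith
  then show ?thesis by (rule cameron_liebler.classification[OF CL])
qed

end
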